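(* There exists $\eta_0>0$ such that for all $\eta\in(0,1)$ with $\eta<\eta_0$ we have $$\frac{H_\eta(i)}{i}\in\left(\log\left(1+\sqrt{2}\right),\infty\right).$$
   Context: Let $h_5:\mathbb{R}\to\mathbb{R}$ be the fifth Hermite polynomial, normalized to have norm $1$ in $L_2(\mathbb{R},e^{-x^2}dx)$, i.e. $$h_5(x)=\frac{4x^5-20x^3+15x}{2\sqrt[4]{\pi}\sqrt{15}}.$$ For $\eta\in(0,1)$ let $f_\eta:\mathbb{R}^2\to\{-1,1\}$ be given by $f_\eta(x_1,x_2)=1$ if $x_2\ge\eta h_5(x_1)$ and $f_\eta(x_1,x_2)=-1$ if $x_2<\eta h_5(x_1)$. For $z\in\mathbb{C}$ with $|\Re(z)|<1$ define $$H_\eta(z)=\frac{1}{2\pi(1-z^2)}\int_{\mathbb{R}^2\times\mathbb{R}^2}f_\eta(x)f_\eta(y)\exp\left(\frac{-\|x\|_2^2-\|y\|_2^2+2z\langle x,y\rangle}{1-z^2}\right)dx\,dy.$$ Here $i$ is the imaginary unit and $\log$ is the natural logarithm. *)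

theory Defs
  imports "HOL-Analysis.Analysis"
begin

text \<open>
  The fifth Hermite polynomial, with unit norm in \<open>L\<^sub>2\<close> of the line with weight \<open>exp (- x\<^sup>2)\<close>.
\<close>
definition h5 :: "real \<Rightarrow> real" where
  "h5 x = (4 * x ^ 5 - 20 * x ^ 3 + 15 * x) / (2 * root 4 pi * sqrt 15)"

text \<open>
  The plane is the type \<open>real \<times> real\<close>, whose library norm and inner product are the Euclidean ones.
\<close>
definition f_eta :: "real \<Rightarrow> real \<times> real \<Rightarrow> real" where
  "f_eta \<eta> x = (if snd x \<ge> \<eta> * h5 (fst x) then 1 else - 1)"

text \<open>
  Only the values on the strip \<open>\<bar>Re z\<bar> < 1\<close> are meaningful: there the integrand is absolutely
  integrable and \<open>1 - z\<^sup>2 \<noteq> 0\<close>. Elsewhere this total function takes library default values.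
\<close>
definition H_eta :: "real \<Rightarrow> complex \<Rightarrow> complex" where
  "H_eta \<eta> z =
     1 / (2 * of_real pi * (1 - z\<^sup>2)) *
     (LINT (x, y) | (lborel :: ((real \<times> real) \<times> (real \<times> real)) measure).
        of_real (f_eta \<eta> x) * of_real (f_eta \<eta> y) *
        exp ((- of_real ((norm x)\<^sup>2) - of_real ((norm y)\<^sup>2) + 2 * z * of_real (x \<bullet> y))
             / (1 - z\<^sup>2)))"

end

theory Submission
  imports Defs "HOL-Probability.Probability"
begin

text \<open>
  Write \<open>g x = exp (- x\<^sup>2 / 2)\<close>. By Fubini, \<open>4 \<pi> H\<^sub>\<eta>(\<i>)\<close> is the integral of
  \<open>g x g y exp (\<i> x y) F(\<eta> h\<^sub>5(x), \<eta> h\<^sub>5(y))\<close> over the plane, where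
  \<open>F(a, b) = \<integral>\<integral> sgn (u - a) sgn (v - b) g u g v exp (\<i> u v) du dv\<close>. The kernel \<open>F\<close> is smooth, and its
  fourth-order Taylor polynomial at the origin has an error that is at most a constant multiple of
  \<open>a\<^sup>6 + a\<^sup>8 + b\<^sup>6 + b\<^sup>8\<close>, so the error contributes \<open>O(\<eta>\<^sup>6)\<close>. The polynomial is integrated
  exactly with the Fourier transforms of \<open>y\<^sup>k g y\<close>. The constant term gives
  \<open>4 \<pi> \<i> ln (1 + sqrt 2)\<close>; the quadratic terms cancel because \<open>h\<^sub>5 g\<close> is an eigenfunction of the Fourier
  transform with eigenvalue \<open>\<i> sqrt (2 \<pi>)\<close>; and the quartic terms add up to \<open>1600 sqrt 2 \<i> \<eta>\<^sup>4\<close>, which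
  dominates the error. The real part of \<open>H\<^sub>\<eta>(\<i>)\<close> vanishes because \<open>h\<^sub>5\<close> is odd.
\<close>

subsection \<open>Reduction to a planar integral\<close>

text \<open>The Hermite function of degree k has the eigenvalue \<open>\<i> ^ k\<close>, in units of
  \<open>sqrt (2 * pi)\<close>, and the quadratic terms cancel exactly when this is
  \<open>\<i>\<close>, so k must be 1 modulo 4. Degree 1 merely rotates a half-plane and leaves
  \<open>H_eta\<close> unchanged; 5 is the next candidate, and the sign is then decided at order
  four. The obstacle is that \<open>h5\<close> is unbounded: however small \<open>\<eta>\<close> is,
  the arguments of the kernel are not confined to a neighbourhood of the origin. Each Taylor
  estimate must therefore hold for all real arguments with polynomial growth, which is where the
  powers of degree eight in the error come from; the Gaussian weight then makes the error
  integrable. Such an estimate controls the imaginary part but can never show that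
  \<open>H_eta \<eta> \<i> / \<i>\<close> is exactly real, so reality needs the separate symmetry
  argument.\<close>

definition gauss :: "real \<Rightarrow> real" where
  "gauss x = exp (- x\<^sup>2 / 2)"

text \<open>The value at 0 copies the convention of \<open>f_eta\<close>, which makes
  \<open>f_eta\<close> a translate of \<open>sg\<close> without exceptions. The price is that
  oddness and multiplicativity fail at 0, so the symmetry arguments below hold only off a null
  set.\<close>

definition sg :: "real \<Rightarrow> real" where
  "sg u = (if u \<ge> 0 then 1 else - 1)"

definition sign_kernel :: "real \<Rightarrow> real \<Rightarrow> complex" where
  "sign_kernel a b = (LBINT u. LBINT v. of_real (sg (u - a) * sg (v - b) * gauss u * gauss v) * cis (u * v))"

lemma gauss_pos [simp]: "gauss x > 0"
  by (simp add: gauss_def)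

lemma gauss_nonneg [simp]: "gauss x \<ge> 0"
  by (simp add: gauss_def)

lemma gauss_minus [simp]: "gauss (- x) = gauss x"
  by (simp add: gauss_def)

lemma gauss_measurable [measurable]: "gauss \<in> borel_measurable borel"
  unfolding gauss_def[abs_def] by measurable

lemma sg_measurable [measurable]: "sg \<in> borel_measurable borel"
  unfolding sg_def[abs_def] by measurable

lemma cis_measurable [measurable]: "cis \<in> borel_measurable borel"
  by (intro borel_measurable_continuous_onI continuous_intros)

lemma abs_sg [simp]: "\<bar>sg u\<bar> = 1"
  by (simp add: sg_def)

lemma gauss_eq_normal: "gauss x = sqrt (2 * pi) * std_normal_density x"
  by (simp add: gauss_def std_normal_density_def)

lemma integrable_gauss_power: "integrable lborel (\<lambda>x. gauss x * x ^ k)"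
  unfolding gauss_eq_normal mult.assoc
  by (intro integrable_mult_right integrable_std_normal_moment)

lemma integrable_gauss_abs_power: "integrable lborel (\<lambda>x. gauss x * \<bar>x\<bar> ^ k)"
  unfolding gauss_eq_normal mult.assoc
  by (intro integrable_mult_right integrable_std_normal_moment_abs)

lemma integrable_gauss: "integrable lborel gauss"
  using integrable_gauss_power[of 0] by simp

lemma integral_gauss: "(LBINT x. gauss x) = sqrt (2 * pi)"
  unfolding gauss_eq_normal by simp

section \<open>Fubini and Gaussian domination on products of Euclidean spaces\<close>

lemma integrable_lborel_mult_prod:
  fixes f :: "'a::euclidean_space \<Rightarrow> real" and g :: "'b::euclidean_space \<Rightarrow> real"
  assumes f: "integrable lborel f" and g: "integrable lborel g"
  shows "integrable lborel (\<lambda>(x, y). f x * g y)"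
proof -
  have [measurable]: "f \<in> borel_measurable lborel" "g \<in> borel_measurable lborel"
    using f g by auto
  have "integrable (lborel \<Otimes>\<^sub>M lborel) (\<lambda>(x, y). f x * g y)"
  proof (rule lborel_pair.Fubini_integrable)
    show "integrable lborel (\<lambda>x. LBINT y. norm (case (x, y) of (x, y) \<Rightarrow> f x * g y))"
      using f by (simp add: abs_mult)
    show "AE x in lborel. integrable lborel (\<lambda>y. case (x, y) of (x, y) \<Rightarrow> f x * g y)"
      using g by simp
  qed measurable
  then show ?thesis by (simp add: lborel_prod)
qed

lemma lborel_Fubini:
  fixes k :: "'a::euclidean_space \<Rightarrow> 'b::euclidean_space \<Rightarrow> 'c::{banach, second_countable_topology}"
  assumes "integrable lborel (case_prod k)"
  shows lborel_integral_fst: "(LINT x|lborel. LINT y|lborel. k x y) = integral\<^sup>L lborel (case_prod k)"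
    and lborel_integral_snd: "(LINT y|lborel. LINT x|lborel. k x y) = integral\<^sup>L lborel (case_prod k)"
    and lborel_integrable_fst: "integrable lborel (\<lambda>x. LINT y|lborel. k x y)"
  using lborel_pair.integral_fst[of k] lborel_pair.integral_snd[of k] lborel_pair.integrable_fst[of k]
    assms by (simp_all add: lborel_prod)

lemma norm_integral_le:
  fixes f :: "'a \<Rightarrow> 'b::{banach, second_countable_topology}"
  assumes "integrable M g" and "\<And>x. norm (f x) \<le> g x"
  shows "norm (integral\<^sup>L M f) \<le> integral\<^sup>L M g"
proof -
  have "(LINT x|M. norm (f x)) \<le> integral\<^sup>L M g"
    by (rule integral_mono') (use assms norm_ge_zero order_trans in blast)+
  with integral_norm_bound show ?thesis
    by (rule order_trans)
qed

lemma integrable_gauss_bound2: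
  fixes k :: "real \<times> real \<Rightarrow> 'c::{banach, second_countable_topology}"
  assumes "k \<in> borel_measurable borel"
    and "\<And>x y. norm (k (x, y)) \<le> C * (gauss x * gauss y)"
  shows "integrable lborel k"
proof (rule Bochner_Integration.integrable_bound)
  show "integrable lborel (\<lambda>p. C * (case p of (x, y) \<Rightarrow> gauss x * gauss y))"
    by (intro integrable_mult_right integrable_lborel_mult_prod integrable_gauss)
  show "AE p in lborel. norm (k p) \<le> norm (C * (case p of (x, y) \<Rightarrow> gauss x * gauss y))"
    using assms(2) by (fastforce intro: order_trans)
qed (use assms(1) in simp)

text \<open>Integrating over pairs of plane vectors yields the order \<open>x1\<close>,
  \<open>x2\<close>, \<open>y1\<close>, \<open>y2\<close>, whereas the reduction needs both second
  coordinates innermost. One exchange of \<open>x2\<close> and \<open>y1\<close>, made after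
  \<open>y2\<close> is integrated out, suffices; the product of four Gaussians dominates at each
  stage.\<close>

lemma lborel_Fubini_quadruple:
  fixes k :: "real \<Rightarrow> real \<Rightarrow> real \<Rightarrow> real \<Rightarrow> complex"
  assumes [measurable]: "(\<lambda>p. k (fst (fst p)) (snd (fst p)) (fst (snd p)) (snd (snd p))) \<in> borel_measurable borel"
    and bound: "\<And>x1 x2 y1 y2. norm (k x1 x2 y1 y2) \<le> gauss x1 * gauss x2 * (gauss y1 * gauss y2)"
  shows "(LINT p|lborel. k (fst (fst p)) (snd (fst p)) (fst (snd p)) (snd (snd p)))
    = (LBINT x1. LBINT y1. LBINT x2. LBINT y2. k x1 x2 y1 y2)"
proof -
  let ?K = "\<lambda>p. k (fst (fst p)) (snd (fst p)) (fst (snd p)) (snd (snd p))"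
  have m2: "(\<lambda>(y :: real \<times> real). ?K (x, y)) \<in> borel_measurable borel" for x
    by measurable
  have intg: "integrable lborel (\<lambda>(x, y). gauss x * gauss y)"
    by (intro integrable_lborel_mult_prod integrable_gauss)
  have "integrable lborel (\<lambda>p. case p of (x, y) \<Rightarrow> (case x of (x1, x2) \<Rightarrow> gauss x1 * gauss x2) * (case y of (y1, y2) \<Rightarrow> gauss y1 * gauss y2))"
    by (rule integrable_lborel_mult_prod[OF intg intg])
  then have "integrable lborel ?K"
    by (rule Bochner_Integration.integrable_bound) (use bound in \<open>auto simp: abs_mult\<close>)
  then have K: "integrable lborel (case_prod (\<lambda>x y. ?K (x, y)))"
    by (simp add: case_prod_unfold)
  have I: "integrable lborel (\<lambda>x. LINT y|lborel. ?K (x, y))"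
    by (rule lborel_integrable_fst[OF K])
  have "integral\<^sup>L lborel ?K = (LINT x|lborel. LINT y|lborel. ?K (x, y))"
    using lborel_integral_fst[OF K] by (simp add: case_prod_unfold)
  also have "\<dots> = (LBINT x1. LBINT x2. LINT y|lborel. ?K ((x1, x2), y))"
    using lborel_integral_fst[of "\<lambda>x1 x2. LINT y|lborel. ?K ((x1, x2), y)"] I
    by (simp add: case_prod_unfold)
  also have "\<dots> = (LBINT x1. LBINT x2. LBINT y1. LBINT y2. k x1 x2 y1 y2)"
  proof (intro Bochner_Integration.integral_cong refl)
    fix x1 x2
    have "integrable lborel (\<lambda>y. ?K ((x1, x2), y))"
      using bound by (intro integrable_gauss_bound2[where C = "gauss x1 * gauss x2"] m2) simp
    then show "(LINT y|lborel. ?K ((x1, x2), y)) = (LBINT y1. LBINT y2. k x1 x2 y1 y2)"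
      using lborel_integral_fst[of "k x1 x2"] by (simp add: case_prod_unfold)
  qed
  also have "\<dots> = (LBINT x1. LBINT y1. LBINT x2. LBINT y2. k x1 x2 y1 y2)"
  proof (rule Bochner_Integration.integral_cong[OF refl])
    fix x1 :: real
    \<comment> \<open>With \<open>x1\<close> fixed, the regrouping \<open>((x2, y1), y2)\<close>
      makes the inner integral a measurable function of the pair \<open>(x2, y1)\<close>, as the
      exchange requires.\<close>
    have "(\<lambda>p :: (real \<times> real) \<times> real. ((x1, fst (fst p)), (snd (fst p), snd p))) \<in> borel \<rightarrow>\<^sub>M borel"
      by (intro borel_measurable_continuous_onI continuous_intros)
    from measurable_compose[OF this assms(1)]
    have "(\<lambda>q. k x1 (fst (fst q)) (snd (fst q)) (snd q)) \<in> borel_measurable (borel \<Otimes>\<^sub>M borel)"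
      by (simp only: borel_prod fst_conv snd_conv)
    then have m3: "(\<lambda>p. LBINT y2. k x1 (fst p) (snd p) y2) \<in> borel_measurable (borel :: (real \<times> real) measure)"
      by (intro lborel.borel_measurable_lebesgue_integral)
        (simp add: case_prod_unfold cong: measurable_cong_sets)
    have "integrable lborel (case_prod (\<lambda>x2 y1. LBINT y2. k x1 x2 y1 y2))"
    proof (rule integrable_gauss_bound2[where C = "gauss x1 * sqrt (2 * pi)"])
      show "(\<lambda>(x2, y1). LBINT y2. k x1 x2 y1 y2) \<in> borel_measurable borel"
        using m3 by (simp only: case_prod_unfold)
      fix x2 y1
      have "norm (LBINT y2. k x1 x2 y1 y2) \<le> (LBINT y2. gauss x1 * gauss x2 * (gauss y1 * gauss y2))"
        using bound by (intro norm_integral_le) (auto intro!: integrable_gauss)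
      also have "\<dots> = gauss x1 * sqrt (2 * pi) * (gauss x2 * gauss y1)"
        by (simp add: integral_gauss)
      finally show "norm (case (x2, y1) of (x2, y1) \<Rightarrow> LBINT y2. k x1 x2 y1 y2) \<le> gauss x1 * sqrt (2 * pi) * (gauss x2 * gauss y1)"
        by simp
    qed
    then show "(LBINT x2. LBINT y1. LBINT y2. k x1 x2 y1 y2) = (LBINT y1. LBINT x2. LBINT y2. k x1 x2 y1 y2)"
      by (simp only: lborel_integral_fst lborel_integral_snd)
  qed
  finally show ?thesis .
qed

lemma h5_measurable [measurable]: "h5 \<in> borel_measurable borel"
  unfolding h5_def[abs_def] by measurable

text \<open>Since \<open>1 - \<i>\<^sup>2 = 2\<close>, the exponential factors into one part in the
  first coordinates and one in the second. The signs compare a second coordinate with a threshold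
  set by the first, so integrating the second coordinates gives the sign kernel at those
  thresholds.\<close>

lemma H_eta_ii:
  "H_eta \<eta> \<i> = 1 / (4 * of_real pi) * (LBINT x. LBINT y. of_real (gauss x * gauss y) * cis (x * y)
     * sign_kernel (\<eta> * h5 x) (\<eta> * h5 y))"
proof -
  let ?s = "\<lambda>x1 x2. sg (x2 - \<eta> * h5 x1)"
  let ?k = "\<lambda>x1 x2 y1 y2. of_real (?s x1 x2 * ?s y1 y2 * (gauss x1 * gauss x2) * (gauss y1 * gauss y2))
    * cis (x1 * y1 + x2 * y2)"
  have f: "f_eta \<eta> x = ?s (fst x) (snd x)" for x
    by (simp add: f_eta_def sg_def)
  have e: "exp ((- of_real ((norm x)\<^sup>2) - of_real ((norm y)\<^sup>2) + 2 * \<i> * of_real (x \<bullet> y)) / (1 - \<i>\<^sup>2))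
      = of_real ((gauss (fst x) * gauss (snd x)) * (gauss (fst y) * gauss (snd y))) * cis (fst x * fst y + snd x * snd y)"
    for x y :: "real \<times> real"
  proof -
    have "(- of_real ((norm x)\<^sup>2) - of_real ((norm y)\<^sup>2) + 2 * \<i> * of_real (x \<bullet> y)) / (1 - \<i>\<^sup>2)
      = of_real ((- (fst x)\<^sup>2 / 2 + - (snd x)\<^sup>2 / 2) + (- (fst y)\<^sup>2 / 2 + - (snd y)\<^sup>2 / 2))
        + \<i> * of_real (fst x * fst y + snd x * snd y)"
      by (cases x; cases y) (simp add: norm_Pair field_simps)
    then show ?thesis
      by (simp only: exp_add exp_of_real cis_conv_exp gauss_def of_real_mult)
  qed
  have "H_eta \<eta> \<i> = 1 / (4 * of_real pi) *
      (LINT p|lborel. ?k (fst (fst p)) (snd (fst p)) (fst (snd p)) (snd (snd p)))"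
    unfolding H_eta_def e f by (simp add: case_prod_unfold mult_ac)
  also have "(LINT p|lborel. ?k (fst (fst p)) (snd (fst p)) (fst (snd p)) (snd (snd p)))
     = (LBINT x1. LBINT y1. LBINT x2. LBINT y2. ?k x1 x2 y1 y2)"
  proof (rule lborel_Fubini_quadruple)
    have [measurable]: "(fst :: (real \<times> real) \<times> real \<times> real \<Rightarrow> _) \<in> borel_measurable borel"
      "(snd :: (real \<times> real) \<times> real \<times> real \<Rightarrow> _) \<in> borel_measurable borel"
      "(fst :: real \<times> real \<Rightarrow> _) \<in> borel_measurable borel" "(snd :: real \<times> real \<Rightarrow> _) \<in> borel_measurable borel"
      by (intro borel_measurable_continuous_onI continuous_intros)+
    show "(\<lambda>p. ?k (fst (fst p)) (snd (fst p)) (fst (snd p)) (snd (snd p))) \<in> borel_measurable borel"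
      by measurable
  qed (simp add: norm_mult abs_mult)
  also have "\<dots> = (LBINT x1. LBINT y1. of_real (gauss x1 * gauss y1) * cis (x1 * y1)
     * sign_kernel (\<eta> * h5 x1) (\<eta> * h5 y1))"
    unfolding sign_kernel_def integral_mult_right_zero[symmetric]
    by (intro Bochner_Integration.integral_cong refl) (simp add: cis_mult[symmetric] mult_ac)
  finally show ?thesis .
qed

subsection \<open>Fourier transforms of Gaussian monomials\<close>

text \<open>This is \<open>\<i> ^ k\<close> times the probabilists' Hermite polynomial of degree k;
  the recursion is the three-term recurrence in the form that integration by parts produces.\<close>

fun fourier_poly :: "nat \<Rightarrow> real \<Rightarrow> complex" where
  "fourier_poly 0 x = 1"
| "fourier_poly (Suc 0) x = \<i> * of_real x"
| "fourier_poly (Suc (Suc k)) x = \<i> * of_real x * fourier_poly (Suc k) x + of_nat (Suc k) * fourier_poly k x"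

lemma gauss_power_tendsto_0: "((\<lambda>y. gauss y * y ^ k) \<longlongrightarrow> 0) at_top" "((\<lambda>y. gauss y * y ^ k) \<longlongrightarrow> 0) at_bot"
proof -
  have "((\<lambda>y::real. exp (y - y\<^sup>2 / 2)) \<longlongrightarrow> 0) at_top"
    by real_asymp
  then have "((\<lambda>y::real. (y ^ k / exp y) * exp (y - y\<^sup>2 / 2)) \<longlongrightarrow> 0 * 0) at_top"
    by (intro tendsto_mult tendsto_power_div_exp_0)
  moreover have "(y ^ k / exp y) * exp (y - y\<^sup>2 / 2) = gauss y * y ^ k" for y
  proof -
    have "gauss y = exp (y - y\<^sup>2 / 2) / exp y"
      by (simp add: gauss_def flip: exp_diff)
    then show ?thesis by simp
  qed
  ultimately show *: "((\<lambda>y. gauss y * y ^ k) \<longlongrightarrow> 0) at_top"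
    by simp
  have "((\<lambda>y. (- 1) ^ k * (gauss y * y ^ k)) \<longlongrightarrow> (- 1) ^ k * 0) at_top"
    by (intro tendsto_mult tendsto_const *)
  then show "((\<lambda>y. gauss y * y ^ k) \<longlongrightarrow> 0) at_bot"
    unfolding filterlim_at_bot_mirror gauss_minus by (subst power_minus) (simp only: mult.left_commute mult_zero_right)
qed

lemma integrable_mult_cis:
  assumes "integrable lborel f"
  shows "integrable lborel (\<lambda>y. of_real (f y) * cis (x * y))"
proof (rule Bochner_Integration.integrable_bound[OF assms])
  have [measurable]: "f \<in> borel_measurable lborel" using assms by auto
  show "(\<lambda>y. of_real (f y) * cis (x * y)) \<in> borel_measurable lborel" by measurable
qed (simp add: norm_mult)

lemma integral_gauss_cis: "(LBINT y. of_real (gauss y) * cis (x * y)) = of_real (sqrt (2 * pi) * gauss x)"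
proof -
  have "of_real (gauss x) = char std_normal_distribution x"
    by (simp add: char_std_normal_distribution gauss_def)
  also have "\<dots> = (LBINT y. std_normal_density y *\<^sub>R cis (x * y))"
    unfolding char_def by (subst integral_density) (auto simp: cis_conv_exp mult_ac)
  finally have "of_real (sqrt (2 * pi)) * of_real (gauss x)
      = of_real (sqrt (2 * pi)) * (LBINT y. std_normal_density y *\<^sub>R cis (x * y))" by simp
  then show ?thesis
    unfolding integral_mult_right_zero[symmetric] of_real_mult
    by (simp add: gauss_eq_normal scaleR_conv_of_real mult_ac)
qed

lemma gauss_DERIV [derivative_intros]: "(gauss has_real_derivative - y * gauss y) (at y)"
  unfolding gauss_def by (auto intro!: derivative_eq_intros)

lemma isCont_gauss_power_cis: "isCont (\<lambda>y. of_real (gauss y * y ^ k) * cis (x * y) :: complex) y"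
proof -
  have "continuous_on UNIV (\<lambda>y. of_real (exp (- y\<^sup>2 / 2) * y ^ k) * cis (x * y) :: complex)"
    by (intro continuous_intros) simp
  then show ?thesis
    by (simp add: continuous_on_eq_continuous_at gauss_def)
qed

text \<open>Integration by parts: the derivative of \<open>gauss y * y ^ k * cis (x * y)\<close> has
  integral 0 because the function vanishes at both ends. For \<open>k = 0\<close> the truncated
  exponent \<open>k - 1\<close> is harmless, its coefficient being 0.\<close>

lemma integral_gauss_power_cis_rec:
  "(LBINT y. of_real (gauss y * y ^ Suc k) * cis (x * y))
    = \<i> * of_real x * (LBINT y. of_real (gauss y * y ^ k) * cis (x * y))
      + of_nat k * (LBINT y. of_real (gauss y * y ^ (k - 1)) * cis (x * y))" (is "?A = _ * ?B + _ * ?C")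
proof -
  let ?F = "\<lambda>y. of_real (gauss y * y ^ k) * cis (x * y)"
  let ?f = "\<lambda>y. \<i> * of_real x * (of_real (gauss y * y ^ k) * cis (x * y))
      + of_nat k * (of_real (gauss y * y ^ (k - 1)) * cis (x * y))
      - of_real (gauss y * y ^ Suc k) * cis (x * y)"
  note int = integrable_mult_cis[OF integrable_gauss_power, of _ x]
  have "(LBINT y=-\<infinity>..\<infinity>. ?f y) = 0 - 0"
  proof (rule interval_integral_FTC_integrable)
    fix y
    have 1: "((\<lambda>y. gauss y * y ^ k) has_real_derivative gauss y * (of_nat k * y ^ (k - 1)) - y * gauss y * y ^ k) (at y)"
      by (rule DERIV_cong[OF DERIV_mult'[OF gauss_DERIV DERIV_pow]]) simp
    have 2: "((\<lambda>y. cis (x * y)) has_vector_derivative x *\<^sub>R (\<i> * cis (x * y))) (at y)"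
      unfolding has_vector_derivative_def by (auto intro!: derivative_eq_intros simp: scaleR_conv_of_real mult_ac)
    have "(?F has_vector_derivative
      of_real (gauss y * y ^ k) * (x *\<^sub>R (\<i> * cis (x * y)))
      + of_real (gauss y * (of_nat k * y ^ (k - 1)) - y * gauss y * y ^ k) * cis (x * y)) (at y)"
      by (intro has_vector_derivative_mult has_vector_derivative_of_real 1 2)
    also have "of_real (gauss y * y ^ k) * (x *\<^sub>R (\<i> * cis (x * y)))
      + of_real (gauss y * (of_nat k * y ^ (k - 1)) - y * gauss y * y ^ k) * cis (x * y) = ?f y"
      by (simp add: algebra_simps scaleR_conv_of_real)
    finally show "(?F has_vector_derivative ?f y) (at y)" .
    show "isCont ?f y"
      by (intro continuous_intros isCont_gauss_power_cis)
  next
    show "set_integrable lborel (einterval (-\<infinity>) \<infinity>) ?f"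
      unfolding set_integrable_def einterval_def
      by (simp del: of_real_mult of_real_power power_Suc)
        (intro Bochner_Integration.integrable_diff Bochner_Integration.integrable_add integrable_mult_right int)
    have n: "(?F \<longlongrightarrow> 0) F" if "((\<lambda>y. gauss y * y ^ k) \<longlongrightarrow> 0) F" for F
      by (rule Lim_null_comparison[OF _ tendsto_norm_zero[OF that]]) (simp add: norm_mult norm_power abs_mult power_abs)
    show "((?F \<circ> real_of_ereal) \<longlongrightarrow> 0) (at_right (- \<infinity>))" "((?F \<circ> real_of_ereal) \<longlongrightarrow> 0) (at_left \<infinity>)"
      unfolding ereal_tendsto_simps by (intro n gauss_power_tendsto_0)+
  qed simp
  also have "(LBINT y=-\<infinity>..\<infinity>. ?f y) = (LBINT y. ?f y)"
    by (simp add: interval_lebesgue_integral_def set_lebesgue_integral_def einterval_def)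
  also have "\<dots> = (\<i> * of_real x * ?B + of_nat k * ?C) - ?A"
    by (simp only: integral_mult_right_zero Bochner_Integration.integral_add Bochner_Integration.integral_diff
      integrable_mult_right Bochner_Integration.integrable_diff Bochner_Integration.integrable_add int)
  finally show ?thesis by simp
qed

lemma integral_gauss_power_cis:
  "(LBINT y. of_real (gauss y * y ^ k) * cis (x * y)) = of_real (sqrt (2 * pi) * gauss x) * fourier_poly k x"
proof (induction k x rule: fourier_poly.induct)
  case (1 x)
  then show ?case using integral_gauss_cis[of x] by simp
next
  case (2 x)
  then show ?case using integral_gauss_power_cis_rec[of 0 x] integral_gauss_cis[of x] by simp
next
  case (3 k x)
  show ?case
    unfolding integral_gauss_power_cis_rec[of "Suc k" x] 3 diff_Suc_1 fourier_poly.simps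
    by (simp only: 3 algebra_simps)
qed

subsection \<open>Taylor expansion of the sign kernel\<close>

text \<open>Integration against \<open>step a\<close> is the oriented integral from \<open>0\<close> to \<open>a\<close>.\<close>
definition step :: "real \<Rightarrow> real \<Rightarrow> real" where
  "step a u = (sg u - sg (u - a)) / 2"

lemma step_eq: "step a u = (if 0 \<le> a then indicator {0..<a} u else - indicator {a..<0} u)"
  by (auto simp: step_def sg_def indicator_def)

lemma abs_step_eq: "\<bar>step a u\<bar> = (if 0 \<le> a then indicator {0..<a} u else indicator {a..<0} u)"
  by (auto simp: step_eq indicator_def)

lemma abs_step_le_1: "\<bar>step a u\<bar> \<le> 1"
  by (auto simp: abs_step_eq indicator_def)

lemma step_nonzero_imp: "step a u \<noteq> 0 \<Longrightarrow> \<bar>u\<bar> \<le> \<bar>a\<bar>"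
  by (auto simp: step_eq indicator_def split: if_splits)

lemma step_measurable [measurable]: "step a \<in> borel_measurable borel"
  unfolding step_def[abs_def] by measurable

lemma integrable_abs_step: "integrable lborel (\<lambda>u. \<bar>step a u\<bar>)"
  unfolding abs_step_eq by (cases "0 \<le> a") simp_all

lemma integral_abs_step: "(LBINT u. \<bar>step a u\<bar>) = \<bar>a\<bar>"
  unfolding abs_step_eq by (cases "0 \<le> a") simp_all

lemma integral_step_power: "(LBINT u. step a u * u ^ k) = a ^ Suc k / Suc k"
proof (cases "0 \<le> a")
  case True
  have "(LBINT u. step a u * u ^ k) = (LBINT u. u ^ k * indicator {0..a} u)"
    using True AE_lborel_singleton[of a] by (intro integral_cong_AE) (auto simp: step_eq indicator_def elim!: eventually_mono)
  with True show ?thesis by (simp add: integral_power)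
next
  case False
  have "(LBINT u. step a u * u ^ k) = (LBINT u. - (u ^ k * indicator {a..0} u))"
    using False AE_lborel_singleton[of 0] by (intro integral_cong_AE) (auto simp: step_eq indicator_def elim!: eventually_mono)
  with False show ?thesis by (simp add: integral_power)
qed

lemma norm_step_mult_le:
  fixes r :: "real \<Rightarrow> 'a::real_normed_vector"
  assumes "\<And>u. \<bar>u\<bar> \<le> \<bar>a\<bar> \<Longrightarrow> norm (r u) \<le> B"
  shows "norm (step a u *\<^sub>R r u) \<le> B * \<bar>step a u\<bar>"
  using assms[of u] step_nonzero_imp[of a u] by (cases "step a u = 0") (auto simp: mult.commute intro: mult_left_mono)

lemma integrable_step_mult:
  fixes r :: "real \<Rightarrow> 'a::{banach, second_countable_topology}"
  assumes "r \<in> borel_measurable borel" "\<And>u. \<bar>u\<bar> \<le> \<bar>a\<bar> \<Longrightarrow> norm (r u) \<le> B"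
  shows "integrable lborel (\<lambda>u. step a u *\<^sub>R r u)"
proof (rule Bochner_Integration.integrable_bound)
  show "integrable lborel (\<lambda>u. B * \<bar>step a u\<bar>)" by (intro integrable_mult_right integrable_abs_step)
  show "AE u in lborel. norm (step a u *\<^sub>R r u) \<le> norm (B * \<bar>step a u\<bar>)"
    by (intro AE_I2 order_trans[OF norm_step_mult_le[OF assms(2)]]) auto
  show "(\<lambda>u. step a u *\<^sub>R r u) \<in> borel_measurable lborel"
    using assms(1) by measurable
qed

text \<open>Since \<open>step a\<close> lives on \<open>\<bar>u\<bar> \<le> \<bar>a\<bar>\<close>, a
  bound there is enough, and integration gains one factor \<open>\<bar>a\<bar>\<close>. This raises
  the order of every Taylor remainder below.\<close>

lemma norm_integral_step_le:
  fixes r :: "real \<Rightarrow> 'a::{banach, second_countable_topology}"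
  assumes "\<And>u. \<bar>u\<bar> \<le> \<bar>a\<bar> \<Longrightarrow> norm (r u) \<le> B"
  shows "norm (LBINT u. step a u *\<^sub>R r u) \<le> B * \<bar>a\<bar>"
proof -
  have "norm (LBINT u. step a u *\<^sub>R r u) \<le> (LBINT u. B * \<bar>step a u\<bar>)"
    by (intro norm_integral_le integrable_mult_right integrable_abs_step norm_step_mult_le assms)
  then show ?thesis by (simp add: integral_abs_step)
qed

text \<open>The half-plane makes a global bound possible. For \<open>norm w \<le> 1\<close> it is
  Taylor's theorem with e at most 3; beyond that \<open>exp w\<close> has norm at most 1, and the
  triangle inequality gives \<open>2 + norm w\<close>, which is at most
  \<open>3 * norm w\<close>.\<close>

lemma norm_exp_minus_linear_le:
  fixes w :: complex
  assumes "Re w \<le> 0"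
  shows "norm (exp w - (1 + w)) \<le> 3 * (norm w)\<^sup>2"
proof (cases "norm w \<le> 1")
  case True
  have "norm (exp w - (1 + w)) \<le> exp (norm w) * (norm w)\<^sup>2"
    using Taylor_exp_field[of w 1] by (simp add: numeral_2_eq_2)
  also have "\<dots> \<le> 3 * (norm w)\<^sup>2"
    using exp_le[THEN order_trans[rotated]] True by (intro mult_right_mono) (auto intro: order_trans[OF _ exp_le])
  finally show ?thesis .
next
  case False
  have "norm (exp w - (1 + w)) \<le> norm (exp w) + norm (1 + w)"
    by (rule norm_triangle_ineq4)
  also have "\<dots> \<le> 1 + (1 + norm w)"
    using assms norm_triangle_ineq[of 1 w] by (intro add_mono) auto
  also have "\<dots> \<le> 3 * norm w" using False by simp
  also have "\<dots> \<le> 3 * (norm w)\<^sup>2"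
    using False self_le_power[of "norm w" 2] by simp
  finally show ?thesis .
qed

section \<open>The sine transform of the signed Gaussian\<close>

lemma abs_sin_minus_cubic_le: "\<bar>sin y - (y - y ^ 3 / 6)\<bar> \<le> \<bar>y\<bar> ^ 5 / (120::real)"
proof -
  have "(\<Sum>m<5. sin_coeff m * y ^ m) = y - y ^ 3 / 6"
    by (simp add: eval_nat_numeral sin_coeff_Suc cos_coeff_Suc)
  then show ?thesis
    using Maclaurin_sin_bound[of y 5] by (simp add: fact_numeral)
qed

lemma integral_gauss_abs_odd: "(LBINT v. gauss v * \<bar>v\<bar> ^ (2 * k + 1)) = 2 * 2 ^ k * fact k"
proof -
  have "(LBINT v. gauss v * \<bar>v\<bar> ^ (2 * k + 1)) = sqrt (2 * pi) * (sqrt (2 / pi) * 2 ^ k * fact k)"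
    unfolding gauss_eq_normal mult.assoc integral_mult_right_zero
    by (subst integral_std_normal_moment_abs_odd) simp
  also have "\<dots> = (sqrt (2 * pi) * sqrt (2 / pi)) * 2 ^ k * fact k"
    by simp
  also have "sqrt (2 * pi) * sqrt (2 / pi) = 2"
    by (simp flip: real_sqrt_mult)
  finally show ?thesis .
qed

text \<open>This is \<open>2 * sqrt 2\<close> times Dawson's function at \<open>u / sqrt 2\<close>.
  It is not elementary, so only its expansion at 0 is used.\<close>

definition sine_transform :: "real \<Rightarrow> real" where
  "sine_transform u = (LBINT v. sg v * gauss v * sin (u * v))"

text \<open>The Maclaurin polynomial of \<open>sin\<close> is integrated termwise. Multiplying an
  odd power of v by \<open>sg v\<close> gives the same power of \<open>\<bar>v\<bar>\<close>, so
  absolute moments appear: 2 and 4 for degrees 1 and 3 give the coefficients 2 and 4/6, and 16 for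
  degree 5 gives the error 16/120, rounded up to 1.\<close>

lemma sine_transform_approx: "\<bar>sine_transform u - (2 * u - 2 * u ^ 3 / 3)\<bar> \<le> \<bar>u\<bar> ^ 5"
proof -
  have i: "integrable lborel (\<lambda>v. sg v * gauss v * sin (u * v))"
    by (rule Bochner_Integration.integrable_bound[OF integrable_gauss]) (auto simp: abs_mult mult_le_cancel_left1)
  have p: "sg v * gauss v * (u * v - (u * v) ^ 3 / 6) = u * (gauss v * \<bar>v\<bar> ^ (2 * 0 + 1)) - u ^ 3 / 6 * (gauss v * \<bar>v\<bar> ^ (2 * 1 + 1))" for v
    by (cases "0 \<le> v") (simp_all add: sg_def power_mult_distrib power3_eq_cube algebra_simps)
  have p1: "integrable lborel (\<lambda>v. sg v * gauss v * (u * v - (u * v) ^ 3 / 6))"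
    unfolding p by (intro Bochner_Integration.integrable_diff integrable_mult_right integrable_gauss_abs_power)
  have p2: "(LBINT v. sg v * gauss v * (u * v - (u * v) ^ 3 / 6)) = 2 * u - 2 * u ^ 3 / 3"
    unfolding p by (subst Bochner_Integration.integral_diff; (intro integrable_mult_right integrable_gauss_abs_power)?)
      (simp only: integral_mult_right_zero integral_gauss_abs_odd, simp add: field_simps)
  have "sine_transform u - (2 * u - 2 * u ^ 3 / 3) = (LBINT v. sg v * gauss v * (sin (u * v) - (u * v - (u * v) ^ 3 / 6)))"
    unfolding sine_transform_def p2[symmetric] right_diff_distrib[of _ "sin _"] using i p1 by simp
  also have "\<bar>\<dots>\<bar> \<le> (LBINT v. \<bar>u\<bar> ^ 5 / 120 * (gauss v * \<bar>v\<bar> ^ (2 * 2 + 1)))"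
  proof (rule norm_integral_le[where 'b = real, unfolded real_norm_def])
    fix v
    show "abs (sg v * gauss v * (sin (u * v) - (u * v - (u * v) ^ 3 / 6))) \<le> \<bar>u\<bar> ^ 5 / 120 * (gauss v * \<bar>v\<bar> ^ (2 * 2 + 1))"
      using mult_left_mono[OF abs_sin_minus_cubic_le[of "u * v"] gauss_nonneg[of v]]
      by (simp add: abs_mult power_mult_distrib mult_ac)
  qed (intro integrable_mult_right integrable_gauss_abs_power)
  also have "\<dots> = \<bar>u\<bar> ^ 5 * (2 * 2 ^ 2 * fact 2 / 120)"
    unfolding integral_mult_right_zero integral_gauss_abs_odd by simp
  also have "\<dots> \<le> \<bar>u\<bar> ^ 5" by (intro mult_left_le) (auto simp: fact_reduce)
  finally show ?thesis .
qed

lemma sg_minus_eq: "sg (u - a) = sg u - 2 * step a u"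
proof -
  have "2 * step a u = sg u - sg (u - a)"
    by (simp add: step_def)
  then show ?thesis by (simp only: diff_diff_eq2 add_diff_cancel_left')
qed

lemma integral_odd_eq_0:
  fixes f :: "real \<Rightarrow> 'a::{banach, second_countable_topology}"
  assumes "f \<in> borel_measurable borel" "\<And>x. x \<noteq> 0 \<Longrightarrow> f (- x) = - f x"
  shows "(LBINT x. f x) = 0"
proof -
  have "(LBINT x. f x) = (LBINT x. f (- x))"
    using lborel_integral_real_affine[of "-1" f 0] by simp
  also have "\<dots> = (LBINT x. - f x)"
    using assms AE_lborel_singleton[of 0]
    by (intro integral_cong_AE) (auto elim!: eventually_mono)
  finally have "2 *\<^sub>R (LBINT x. f x) = 0"
    by (simp add: scaleR_2 add_eq_0_iff2)
  then show ?thesis by simp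
qed

lemma integral_sg_gauss_cis: "(LBINT v. of_real (sg v * gauss v) * cis (u * v)) = \<i> * of_real (sine_transform u)"
proof -
  have i: "integrable lborel (\<lambda>v. sg v * gauss v * f (u * v))" if "f = sin \<or> f = cos" for f
    using that by (intro Bochner_Integration.integrable_bound[OF integrable_gauss])
      (auto simp: abs_mult mult_le_cancel_left1)
  have "(LBINT v. sg v * gauss v * cos (u * v)) = 0"
    by (rule integral_odd_eq_0) (auto simp: sg_def)
  moreover have "of_real (sg v * gauss v) * cis (u * v) = of_real (sg v * gauss v * cos (u * v)) + \<i> * of_real (sg v * gauss v * sin (u * v))" for v
    by (simp add: complex_eq_iff)
  ultimately show ?thesis
    using i[of sin] i[of cos] unfolding sine_transform_def
    by (simp del: of_real_mult)
qed

section \<open>Bilinear decomposition of the sign kernel and expansion of its parts\<close>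

definition fourier_form :: "(real \<Rightarrow> real) \<Rightarrow> (real \<Rightarrow> real) \<Rightarrow> complex" where
  "fourier_form p q = (LBINT u. LBINT v. of_real (p u * q v * (gauss u * gauss v)) * cis (u * v))"

lemma integrable_fourier_form:
  assumes [measurable]: "p \<in> borel_measurable borel" "q \<in> borel_measurable borel"
    and "\<And>u. \<bar>p u\<bar> \<le> 1" "\<And>u. \<bar>q u\<bar> \<le> 1"
  shows "integrable lborel (\<lambda>(u, v). of_real (p u * q v * (gauss u * gauss v)) * cis (u * v))"
proof (rule integrable_gauss_bound2[where C = 1])
  have [measurable]: "(fst :: real \<times> real \<Rightarrow> _) \<in> borel_measurable borel" "(snd :: real \<times> real \<Rightarrow> _) \<in> borel_measurable borel"
    by (intro borel_measurable_continuous_onI continuous_intros)+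
  show "(\<lambda>(u, v). of_real (p u * q v * (gauss u * gauss v)) * cis (u * v)) \<in> borel_measurable borel"
    unfolding case_prod_unfold by measurable
  have "\<bar>p u * q v\<bar> \<le> 1" for u v
    using assms(3)[of u] assms(4)[of v] by (simp add: abs_mult mult_le_one)
  then show "norm (case (u, v) of (u, v) \<Rightarrow> of_real (p u * q v * (gauss u * gauss v)) * cis (u * v)) \<le> 1 * (gauss u * gauss v)" for u v
    by (simp add: norm_mult abs_mult mult_left_le_one_le)
qed

lemma fourier_form_commute:
  assumes "p \<in> borel_measurable borel" "q \<in> borel_measurable borel"
    and "\<And>u. \<bar>p u\<bar> \<le> 1" "\<And>u. \<bar>q u\<bar> \<le> 1"
  shows "fourier_form p q = fourier_form q p"
proof -
  note i = integrable_fourier_form[OF assms]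
  show ?thesis
    using lborel_integral_fst[OF i] lborel_integral_snd[OF i] unfolding fourier_form_def by (simp add: mult_ac)
qed

text \<open>Replace each shifted sign by \<open>sg u - 2 * step a u\<close> and expand bilinearly.
  Only the last term couples a and b, and the symmetry of the form reduces both linear terms to one
  function of a single variable.\<close>

lemma sign_kernel_eq: "sign_kernel a b = sign_kernel 0 0 - 2 * fourier_form (step a) sg - 2 * fourier_form (step b) sg + 4 * fourier_form (step a) (step b)"
proof -
  let ?k = "\<lambda>p q (u, v). of_real (p u * q v * (gauss u * gauss v)) * cis (u * v)"
  have s: "sg \<in> borel_measurable borel" "\<And>u. \<bar>sg u\<bar> \<le> 1" by auto
  note i = integrable_fourier_form[OF s(1) s(1) s(2) s(2)]
    integrable_fourier_form[OF step_measurable s(1) abs_step_le_1 s(2), of a]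
    integrable_fourier_form[OF s(1) step_measurable s(2) abs_step_le_1, of b]
    integrable_fourier_form[OF step_measurable step_measurable abs_step_le_1 abs_step_le_1, of a b]
  have b: "fourier_form p q = integral\<^sup>L lborel (?k p q)" if "integrable lborel (?k p q)" for p q
    using lborel_integral_fst[OF that] by (simp add: fourier_form_def)
  have "integrable lborel (\<lambda>(u, v). of_real (sg (u - a) * sg (v - b) * (gauss u * gauss v)) * cis (u * v))"
    by (rule integrable_fourier_form) auto
  from lborel_integral_fst[OF this]
  have "sign_kernel a b = integral\<^sup>L lborel (\<lambda>(u, v). of_real (sg (u - a) * sg (v - b) * (gauss u * gauss v)) * cis (u * v))"
    by (simp add: sign_kernel_def mult_ac)
  also have "\<dots> = integral\<^sup>L lborel (\<lambda>p. ?k sg sg p - 2 * ?k (step a) sg p - 2 * ?k sg (step b) p + 4 * ?k (step a) (step b) p)"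
    by (intro Bochner_Integration.integral_cong) (auto simp: sg_minus_eq algebra_simps)
  also have "\<dots> = fourier_form sg sg - 2 * fourier_form (step a) sg - 2 * fourier_form sg (step b) + 4 * fourier_form (step a) (step b)"
    unfolding b[OF i(1)] b[OF i(2)] b[OF i(3)] b[OF i(4)]
    using i by (simp only: integral_mult_right_zero Bochner_Integration.integral_add
      Bochner_Integration.integral_diff integrable_mult_right Bochner_Integration.integrable_diff Bochner_Integration.integrable_add)
  also have "fourier_form sg sg = sign_kernel 0 0"
    by (simp add: fourier_form_def sign_kernel_def mult_ac)
  also have "fourier_form sg (step b) = fourier_form (step b) sg"
    by (rule fourier_form_commute) (auto simp: abs_step_le_1)
  finally show ?thesis .
qed

lemma abs_gauss_minus_quadratic_le: "\<bar>gauss u - (1 - u\<^sup>2 / 2)\<bar> \<le> 3 / 4 * u ^ 4"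
proof -
  have "norm (of_real (gauss u - (1 - u\<^sup>2 / 2)) :: complex) \<le> 3 * (norm (of_real (- u\<^sup>2 / 2) :: complex))\<^sup>2"
    using norm_exp_minus_linear_le[of "of_real (- u\<^sup>2 / 2)"] by (simp add: gauss_def exp_of_real[symmetric])
  then show ?thesis
    unfolding norm_of_real by (simp add: power_divide)
qed

text \<open>The product of \<open>1 - u\<^sup>2 / 2\<close> and \<open>2 * u - 2 * u ^ 3 / 3\<close>
  has the cubic coefficient -2/3 - 1 = -5/3 and leaves \<open>u ^ 5 / 3\<close> for the error. The
  fifth powers add up to 1 + 3/2 + 1/3, which is below 3.\<close>

lemma gauss_sine_transform_approx: "\<bar>gauss u * sine_transform u - (2 * u - 5 / 3 * u ^ 3)\<bar> \<le> 3 * \<bar>u\<bar> ^ 5 + \<bar>u\<bar> ^ 7"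
proof -
  have eq: "gauss u * sine_transform u - (2 * u - 5 / 3 * u ^ 3)
    = gauss u * (sine_transform u - (2 * u - 2 * u ^ 3 / 3)) + ((gauss u - (1 - u\<^sup>2 / 2)) * (2 * u - 2 * u ^ 3 / 3) + u ^ 5 / 3)"
    by (simp add: eval_nat_numeral field_simps)
  have "\<bar>gauss u * (sine_transform u - (2 * u - 2 * u ^ 3 / 3)) + ((gauss u - (1 - u\<^sup>2 / 2)) * (2 * u - 2 * u ^ 3 / 3) + u ^ 5 / 3)\<bar> \<le> \<bar>u\<bar> ^ 5 + (3 / 4 * u ^ 4 * (2 * \<bar>u\<bar> + 2 * \<bar>u\<bar> ^ 3 / 3) + \<bar>u\<bar> ^ 5 / 3)"
  proof (intro order_trans[OF abs_triangle_ineq] add_mono)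
    have "gauss u \<le> 1" by (simp add: gauss_def)
    then show "\<bar>gauss u * (sine_transform u - (2 * u - 2 * u ^ 3 / 3))\<bar> \<le> \<bar>u\<bar> ^ 5"
      using mult_mono[OF _ sine_transform_approx[of u], of "gauss u" 1] by (simp add: abs_mult)
    have "\<bar>2 * u - 2 * u ^ 3 / 3\<bar> \<le> 2 * \<bar>u\<bar> + 2 * \<bar>u\<bar> ^ 3 / 3"
      using abs_triangle_ineq4[of "2 * u" "2 * u ^ 3 / 3"] by (simp add: abs_mult power_abs)
    then show "\<bar>(gauss u - (1 - u\<^sup>2 / 2)) * (2 * u - 2 * u ^ 3 / 3)\<bar> \<le> 3 / 4 * u ^ 4 * (2 * \<bar>u\<bar> + 2 * \<bar>u\<bar> ^ 3 / 3)"
      unfolding abs_mult by (intro mult_mono abs_gauss_minus_quadratic_le) auto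
    show "\<bar>u ^ 5 / 3\<bar> \<le> \<bar>u\<bar> ^ 5 / 3"
      by (simp only: abs_divide power_abs abs_numeral order_refl)
  qed
  then have *: "\<bar>gauss u * sine_transform u - (2 * u - 5 / 3 * u ^ 3)\<bar>
    \<le> \<bar>u\<bar> ^ 5 + (3 / 4 * u ^ 4 * (2 * \<bar>u\<bar> + 2 * \<bar>u\<bar> ^ 3 / 3) + \<bar>u\<bar> ^ 5 / 3)"
    by (simp only: eq)
  have "3 / 4 * u ^ 4 * (2 * \<bar>u\<bar> + 2 * \<bar>u\<bar> ^ 3 / 3) = 3 / 2 * \<bar>u\<bar> ^ 5 + 1 / 2 * \<bar>u\<bar> ^ 7"
  proof -
    define w where "w = \<bar>u\<bar>"
    have u4: "u ^ 4 = w ^ 4"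
      by (simp add: w_def)
    have w: "w ^ 5 = w ^ 4 * w" "w ^ 7 = w ^ 4 * w ^ 3"
      using power_add[of w 4 1] power_add[of w 4 3] by simp_all
    show ?thesis
      unfolding u4 w_def[symmetric] w by (simp add: algebra_simps)
  qed
  then show ?thesis
    using * zero_le_power[of "\<bar>u\<bar>" 5] zero_le_power[of "\<bar>u\<bar>" 7] by linarith
qed

text \<open>The integral over v is \<open>\<i> * sine_transform u\<close>, so the form is the
  oriented integral from 0 to a of \<open>\<i> * gauss u * sine_transform u\<close>; integrating
  \<open>2 * u - 5 / 3 * u ^ 3\<close> gives the main term.\<close>

lemma fourier_form_step_sg_approx: "norm (fourier_form (step a) sg - \<i> * of_real (a\<^sup>2 - 5 / 12 * a ^ 4)) \<le> 3 * a ^ 6 + a ^ 8"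
proof -
  let ?B = "3 * \<bar>a\<bar> ^ 5 + \<bar>a\<bar> ^ 7"
  let ?q = "\<lambda>u. 2 * u - 5 / 3 * u ^ 3"
  have [measurable]: "sine_transform \<in> borel_measurable borel"
    unfolding sine_transform_def[abs_def] by measurable
  have r: "norm (gauss u * sine_transform u - ?q u) \<le> ?B" if "\<bar>u\<bar> \<le> \<bar>a\<bar>" for u
    using gauss_sine_transform_approx[of u] power_mono[OF that, of 5] power_mono[OF that, of 7]
    unfolding real_norm_def by linarith
  have sp: "integrable lborel (\<lambda>u. step a u *\<^sub>R u ^ k)" for k
    by (rule integrable_step_mult[where B = "\<bar>a\<bar> ^ k"]) (auto simp: power_abs intro: power_mono)
  have ir: "integrable lborel (\<lambda>u. step a u *\<^sub>R (gauss u * sine_transform u - ?q u))"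
    using r by (intro integrable_step_mult[where B = ?B]) auto
  have q: "step a u *\<^sub>R ?q u = 2 * (step a u *\<^sub>R u ^ 1) - 5 / 3 * (step a u *\<^sub>R u ^ 3)" for u
    by (simp add: algebra_simps)
  have iq: "integrable lborel (\<lambda>u. step a u *\<^sub>R ?q u)"
    unfolding q using sp[of 1] sp[of 3] by (intro Bochner_Integration.integrable_diff integrable_mult_right) auto
  have Iq: "(LBINT u. step a u *\<^sub>R ?q u) = a\<^sup>2 - 5 / 12 * a ^ 4"
  proof -
    have "(LBINT u. step a u *\<^sub>R ?q u) = 2 * (LBINT u. step a u *\<^sub>R u ^ 1) - 5 / 3 * (LBINT u. step a u *\<^sub>R u ^ 3)"
      unfolding q using sp[of 1] sp[of 3]
      by (subst Bochner_Integration.integral_diff; (intro integrable_mult_right)?) (simp_all only: integral_mult_right_zero)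
    then show ?thesis
      using integral_step_power[of a 1] integral_step_power[of a 3] by (simp add: eval_nat_numeral)
  qed
  have "fourier_form (step a) sg = (LBINT u. of_real (step a u * gauss u) * (LBINT v. of_real (sg v * gauss v) * cis (u * v)))"
    unfolding fourier_form_def integral_mult_right_zero[symmetric]
    by (intro Bochner_Integration.integral_cong refl) (simp add: mult_ac)
  also have "\<dots> = (LBINT u. \<i> * of_real (step a u *\<^sub>R (gauss u * sine_transform u - ?q u) + step a u *\<^sub>R ?q u))"
    unfolding integral_sg_gauss_cis by (intro Bochner_Integration.integral_cong refl) (simp add: algebra_simps)
  also have "\<dots> = \<i> * of_real ((LBINT u. step a u *\<^sub>R (gauss u * sine_transform u - ?q u)) + (a\<^sup>2 - 5 / 12 * a ^ 4))"
    unfolding Iq[symmetric] integral_mult_right_zero integral_complex_of_real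
    using ir iq by (subst Bochner_Integration.integral_add) auto
  finally have "fourier_form (step a) sg - \<i> * of_real (a\<^sup>2 - 5 / 12 * a ^ 4)
     = \<i> * of_real (LBINT u. step a u *\<^sub>R (gauss u * sine_transform u - ?q u))"
    by (simp add: algebra_simps)
  also have "norm \<dots> \<le> ?B * \<bar>a\<bar>"
    using norm_integral_step_le[OF r] by (simp only: norm_mult norm_ii mult_1 norm_of_real real_norm_def)
  also have "\<dots> = 3 * \<bar>a\<bar> ^ 6 + \<bar>a\<bar> ^ 8"
    by (simp add: eval_nat_numeral algebra_simps)
  finally show ?thesis by simp
qed

text \<open>Used twice in the double integral that follows: a quadratic integrand in v leaves, after
  integration, a quadratic polynomial in u.\<close>

lemma
  fixes c d e :: complex
  shows integrable_step_quadratic: "integrable lborel (\<lambda>v. step b v *\<^sub>R (c + d * of_real v + e * of_real (v\<^sup>2)))" (is ?A)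
    and integral_step_quadratic: "(LBINT v. step b v *\<^sub>R (c + d * of_real v + e * of_real (v\<^sup>2)))
      = c * of_real b + d * of_real (b\<^sup>2 / 2) + e * of_real (b ^ 3 / 3)" (is ?B)
proof -
  have sp: "integrable lborel (\<lambda>v. of_real (step b v * v ^ k) :: complex)" for k
  proof -
    have "integrable lborel (\<lambda>v. step b v *\<^sub>R v ^ k)"
      by (rule integrable_step_mult[where B = "\<bar>b\<bar> ^ k"]) (auto simp: power_abs intro: power_mono)
    then show ?thesis by (simp del: of_real_mult)
  qed
  have eq: "step b v *\<^sub>R (c + d * of_real v + e * of_real (v\<^sup>2)) = c * of_real (step b v * v ^ 0) + d * of_real (step b v * v ^ 1)
     + e * of_real (step b v * v ^ 2)" for v
    by (simp add: scaleR_conv_of_real algebra_simps)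
  have "(LBINT v. step b v *\<^sub>R (c + d * of_real v + e * of_real (v\<^sup>2)))
    = c * of_real (LBINT v. step b v * v ^ 0) + d * of_real (LBINT v. step b v * v ^ 1) + e * of_real (LBINT v. step b v * v ^ 2)"
    unfolding eq integral_complex_of_real[symmetric]
    using sp by (simp only: integral_mult_right_zero Bochner_Integration.integral_add integrable_mult_right Bochner_Integration.integrable_add)
  then show ?B
    unfolding integral_step_power by (simp add: eval_nat_numeral)
  show ?A
    unfolding eq using sp by (intro Bochner_Integration.integrable_add integrable_mult_right)
qed

text \<open>The integrand is \<open>exp w\<close> with w = -(u^2 + v^2)/2 + i u v, and the main term
  is the integral of \<open>1 + w\<close> over the oriented rectangle. There w has norm at most
  \<open>a\<^sup>2 + b\<^sup>2\<close>; the area supplies two more degrees, so linearising the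
  exponential already leaves an error of degree six.\<close>

lemma fourier_form_step_step_approx:
  "norm (fourier_form (step a) (step b) - of_real (a * b - (a ^ 3 * b + a * b ^ 3) / 6) - \<i> * of_real (a\<^sup>2 * b\<^sup>2 / 4))
    \<le> 3 * (a\<^sup>2 + b\<^sup>2)\<^sup>2 * \<bar>b\<bar> * \<bar>a\<bar>"
proof -
  let ?E = "\<lambda>u v. of_real (gauss u * gauss v) * cis (u * v)"
  let ?p = "\<lambda>u v. of_real (1 - u\<^sup>2 / 2) + \<i> * of_real u * of_real v + (- 1 / 2) * of_real (v\<^sup>2)"
  let ?B = "3 * (a\<^sup>2 + b\<^sup>2)\<^sup>2"
  have r: "norm (?E u v - ?p u v) \<le> ?B" if uv: "\<bar>u\<bar> \<le> \<bar>a\<bar>" "\<bar>v\<bar> \<le> \<bar>b\<bar>" for u v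
  proof -
    define w where "w = Complex (- (u\<^sup>2 + v\<^sup>2) / 2) (u * v)"
    have "of_real (gauss u * gauss v) = exp (of_real (- (u\<^sup>2 + v\<^sup>2) / 2) :: complex)"
      unfolding exp_of_real by (simp add: gauss_def exp_add[symmetric] add_divide_distrib del: of_real_mult)
    then have E: "?E u v = exp w"
      by (simp add: w_def cis_conv_exp exp_add[symmetric] Complex_eq)
    have p: "?p u v = 1 + w"
      by (simp add: w_def complex_eq_iff field_simps)
    have "norm w \<le> a\<^sup>2 + b\<^sup>2"
    proof -
      have "norm w \<le> (u\<^sup>2 + v\<^sup>2) / 2 + \<bar>u * v\<bar>"
        using cmod_le[of w] by (simp add: w_def add.commute)
      also have "\<bar>u * v\<bar> \<le> (u\<^sup>2 + v\<^sup>2) / 2"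
        using sum_squares_bound[of "\<bar>u\<bar>" "\<bar>v\<bar>"] by (simp add: abs_mult)
      also have "(u\<^sup>2 + v\<^sup>2) / 2 + (u\<^sup>2 + v\<^sup>2) / 2 \<le> a\<^sup>2 + b\<^sup>2"
        using uv by (simp add: abs_le_square_iff)
      finally show ?thesis by simp
    qed
    then have "3 * (norm w)\<^sup>2 \<le> ?B"
      by (simp add: power_mono)
    moreover have "norm (exp w - (1 + w)) \<le> 3 * (norm w)\<^sup>2"
      by (rule norm_exp_minus_linear_le) (simp add: w_def)
    ultimately show ?thesis
      unfolding E p by (rule order_trans[rotated])
  qed
  have p_int: "integrable lborel (\<lambda>v. step b v *\<^sub>R ?p u v)" for u
    by (rule integrable_step_quadratic)
  have E_int: "integrable lborel (\<lambda>v. step b v *\<^sub>R ?E u v)" for u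
    by (rule integrable_step_mult[where B = 1]) (auto simp: norm_mult gauss_def exp_le_one_iff mult_le_one)
  let ?P = "\<lambda>u. (LBINT v. step b v *\<^sub>R ?p u v)"
  let ?I = "\<lambda>u. (LBINT v. step b v *\<^sub>R ?E u v)"
  have P: "?P u = of_real (b - b ^ 3 / 6) + \<i> * of_real (b\<^sup>2 / 2) * of_real u + of_real (- b / 2) * of_real (u\<^sup>2)" for u
    unfolding integral_step_quadratic by (simp add: complex_eq_iff field_simps)
  have IP: "norm (?I u - ?P u) \<le> ?B * \<bar>b\<bar>" if "\<bar>u\<bar> \<le> \<bar>a\<bar>" for u
  proof -
    have "?I u - ?P u = (LBINT v. step b v *\<^sub>R (?E u v - ?p u v))"
      unfolding scaleR_diff_right using E_int[of u] p_int[of u] by (rule Bochner_Integration.integral_diff[symmetric])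
    then show ?thesis
      using norm_integral_step_le[OF r[OF that]] by simp
  qed
  have P_int: "integrable lborel (\<lambda>u. step a u *\<^sub>R ?P u)"
    unfolding P by (rule integrable_step_quadratic)
  have I_int: "integrable lborel (\<lambda>u. step a u *\<^sub>R ?I u)"
    by (rule integrable_step_mult[where B = "1 * \<bar>b\<bar>"], measurable)
      (rule norm_integral_step_le, auto simp: norm_mult gauss_def mult_le_one)
  have "fourier_form (step a) (step b) = (LBINT u. step a u *\<^sub>R ?I u)"
    unfolding fourier_form_def integral_scaleR_right[symmetric]
    by (intro Bochner_Integration.integral_cong refl) (simp add: scaleR_conv_of_real mult_ac)
  moreover have "of_real (a * b - (a ^ 3 * b + a * b ^ 3) / 6) + \<i> * of_real (a\<^sup>2 * b\<^sup>2 / 4) = (LBINT u. step a u *\<^sub>R ?P u)"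
    unfolding P integral_step_quadratic by (simp add: complex_eq_iff field_simps)
  moreover have "(LBINT u. step a u *\<^sub>R ?I u) - (LBINT u. step a u *\<^sub>R ?P u) = (LBINT u. step a u *\<^sub>R (?I u - ?P u))"
    unfolding scaleR_diff_right using I_int P_int by (rule Bochner_Integration.integral_diff[symmetric])
  moreover have "norm (LBINT u. step a u *\<^sub>R (?I u - ?P u)) \<le> ?B * \<bar>b\<bar> * \<bar>a\<bar>"
    by (rule norm_integral_step_le[OF IP])
  ultimately show ?thesis
    by (simp only: diff_diff_eq)
qed

lemma sign_kernel_approx:
  "norm (sign_kernel a b - (sign_kernel 0 0 - 2 * \<i> * of_real (a\<^sup>2 - 5 / 12 * a ^ 4) - 2 * \<i> * of_real (b\<^sup>2 - 5 / 12 * b ^ 4)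
      + 4 * of_real (a * b - (a ^ 3 * b + a * b ^ 3) / 6) + \<i> * of_real (a\<^sup>2 * b\<^sup>2)))
    \<le> 30 * (a ^ 6 + a ^ 8 + b ^ 6 + b ^ 8)" (is "cmod (?F - (?Z - ?A - ?B + ?C + ?D)) \<le> _")
proof -
  let ?x = "fourier_form (step a) sg - \<i> * of_real (a\<^sup>2 - 5 / 12 * a ^ 4)"
  let ?y = "fourier_form (step b) sg - \<i> * of_real (b\<^sup>2 - 5 / 12 * b ^ 4)"
  let ?z = "fourier_form (step a) (step b) - of_real (a * b - (a ^ 3 * b + a * b ^ 3) / 6) - \<i> * of_real (a\<^sup>2 * b\<^sup>2 / 4)"
  have tri: "norm (- 2 * x - 2 * y + 4 * z) \<le> 2 * norm x + 2 * norm y + 4 * norm z" for x y z :: complex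
    using norm_triangle_ineq[of "- 2 * x - 2 * y" "4 * z"] norm_triangle_ineq4[of "- 2 * x" "2 * y"]
    by (simp add: norm_mult)
  have *: "?F - (?Z - ?A - ?B + ?C + ?D) = - 2 * ?x - 2 * ?y + 4 * ?z"
    unfolding sign_kernel_eq[of a b] by (simp add: algebra_simps)
  have "norm (- 2 * ?x - 2 * ?y + 4 * ?z) \<le> 2 * norm ?x + 2 * norm ?y + 4 * norm ?z"
    by (rule tri)
  also have "\<dots> \<le> 2 * (3 * a ^ 6 + a ^ 8) + 2 * (3 * b ^ 6 + b ^ 8) + 4 * (3 * ((a\<^sup>2 + b\<^sup>2)\<^sup>2 * (\<bar>b\<bar> * \<bar>a\<bar>)))"
    by (intro add_mono mult_left_mono fourier_form_step_sg_approx fourier_form_step_step_approx[unfolded mult.assoc]) auto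
  finally have **: "norm (- 2 * ?x - 2 * ?y + 4 * ?z)
    \<le> 2 * (3 * a ^ 6 + a ^ 8) + 2 * (3 * b ^ 6 + b ^ 8) + 4 * (3 * ((a\<^sup>2 + b\<^sup>2)\<^sup>2 * (\<bar>b\<bar> * \<bar>a\<bar>)))" .
  have "(a\<^sup>2 + b\<^sup>2)\<^sup>2 * (\<bar>b\<bar> * \<bar>a\<bar>) \<le> (a\<^sup>2 + b\<^sup>2)\<^sup>2 * ((a\<^sup>2 + b\<^sup>2) / 2)"
    using sum_squares_bound[of "\<bar>a\<bar>" "\<bar>b\<bar>"] by (intro mult_left_mono) (auto simp: mult_ac)
  also have "\<dots> \<le> 2 * (a ^ 6 + b ^ 6)"
  proof -
    have "(a\<^sup>2 + b\<^sup>2)\<^sup>2 * ((a\<^sup>2 + b\<^sup>2) / 2) = 2 * (a ^ 6 + b ^ 6) - 3 / 2 * ((a\<^sup>2 + b\<^sup>2) * (a\<^sup>2 - b\<^sup>2)\<^sup>2)"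
    proof -
      \<comment> \<open>With s and t the squares of a and b, this is the power mean inequality
        between the first and third powers, with the defect displayed as a nonnegative term.\<close>
      have "(s + t)\<^sup>2 * ((s + t) / 2) = 2 * (s ^ 3 + t ^ 3) - 3 / 2 * ((s + t) * (s - t)\<^sup>2)" for s t :: real
        by (simp add: power2_eq_square power3_eq_cube field_simps)
      from this[of "a\<^sup>2" "b\<^sup>2"] show ?thesis by (simp flip: power_mult)
    qed
    then show ?thesis by simp
  qed
  finally have R: "(a\<^sup>2 + b\<^sup>2)\<^sup>2 * (\<bar>b\<bar> * \<bar>a\<bar>) \<le> 2 * (a ^ 6 + b ^ 6)" .
  \<comment> \<open>The sixth powers carry the coefficient 2 * 3 + 4 * 3 * 2 = 30, the largest one;
    the eighth powers only need 2.\<close>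
  have lin: "2 * (3 * a6 + a8) + 2 * (3 * b6 + b8) + 4 * (3 * r) \<le> 30 * (a6 + a8 + b6 + b8)"
    if "r \<le> 2 * (a6 + b6)" "0 \<le> a8" "0 \<le> b8" for r a6 a8 b6 b8 :: real
    using that by simp
  from order_trans[OF ** lin[OF R zero_le_even_power zero_le_even_power]] show ?thesis
    unfolding * by simp
qed

subsection \<open>The sign kernel at the origin\<close>

lemma integrable_abs_gaussian:
  fixes b :: real
  assumes "b > 0"
  shows "integrable lborel (\<lambda>u. \<bar>u\<bar> * exp (- b * u\<^sup>2))"
proof -
  define c where "c = sqrt (2 * b)"
  have c: "c > 0" "c\<^sup>2 = 2 * b"
    using assms by (auto simp: c_def)
  have "integrable lborel (\<lambda>u. gauss u * \<bar>u\<bar>)"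
    using integrable_gauss_abs_power[of 1] by simp
  then have "integrable lborel (\<lambda>u. 1 / c * (gauss (0 + c * u) * \<bar>0 + c * u\<bar>))"
    using c by (intro integrable_mult_right) (subst lborel_integrable_real_affine_iff, auto)
  also have "(\<lambda>u. 1 / c * (gauss (0 + c * u) * \<bar>0 + c * u\<bar>)) = (\<lambda>u. \<bar>u\<bar> * exp (- b * u\<^sup>2))"
    using c by (auto simp: fun_eq_iff gauss_def abs_mult power_mult_distrib)
  finally show ?thesis .
qed

text \<open>The factor \<open>\<bar>u\<bar>\<close> is the Jacobian of the substitution
  \<open>v = u * t\<close> made in \<open>sign_kernel_0_0\<close>. It gives the complex Gaussian an
  elementary primitive on the half-line; evenness doubles the result.\<close>

lemma
  fixes \<beta> :: complex
  assumes "Re \<beta> > 0"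
  shows integrable_abs_complex_gaussian: "integrable lborel (\<lambda>u. of_real \<bar>u\<bar> * exp (- \<beta> * of_real (u\<^sup>2)))" (is "integrable _ ?f")
    and integral_abs_complex_gaussian: "(LBINT u. of_real \<bar>u\<bar> * exp (- \<beta> * of_real (u\<^sup>2))) = 1 / \<beta>"
proof -
  have n: "norm (exp (- \<beta> * of_real (u\<^sup>2))) = exp (- Re \<beta> * u\<^sup>2)" for u
    by (simp add: norm_exp_eq_Re)
  have meas: "?f \<in> borel_measurable borel"
    by (intro borel_measurable_continuous_onI continuous_intros)
  show int: "integrable lborel ?f"
    by (rule Bochner_Integration.integrable_bound[OF integrable_abs_gaussian[OF assms]])
      (use meas in \<open>auto simp: norm_mult norm_exp_eq_Re\<close>)
  have [simp]: "\<beta> \<noteq> 0" using assms by auto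
  let ?g = "\<lambda>u. of_real u * exp (- \<beta> * of_real (u\<^sup>2))"
  let ?G = "\<lambda>u. - exp (- \<beta> * of_real (u\<^sup>2)) / (2 * \<beta>)"
  \<comment> \<open>Both functions vanish at 0, so the closed and the open half-line can be
    interchanged pointwise.\<close>
  have ind: "indicator {0..} u *\<^sub>R ?f u = indicator (einterval 0 \<infinity>) u *\<^sub>R ?g u" for u
    by (auto simp: indicator_def einterval_def)
  have set_int: "set_integrable lborel (einterval 0 \<infinity>) ?g"
    using integrable_mult_indicator[OF _ int, of "{0..}"] unfolding ind set_integrable_def by simp
  have "(LBINT u=0..\<infinity>. ?g u) = 0 - (- 1 / (2 * \<beta>))"
  proof (rule interval_integral_FTC_integrable[OF _ _ _ set_int])
    fix u :: real
    show "(?G has_vector_derivative ?g u) (at u)"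
    proof -
      have "((\<lambda>z. - exp (- \<beta> * z\<^sup>2) / (2 * \<beta>)) has_field_derivative of_real u * exp (- \<beta> * (of_real u)\<^sup>2)) (at (of_real u))"
        by (auto intro!: derivative_eq_intros)
      from has_vector_derivative_real_field[OF this] show ?thesis
        by simp
    qed
    show "isCont ?g u"
      by (intro continuous_intros)
  next
    have lim: "((\<lambda>u. exp (- Re \<beta> * u\<^sup>2)) \<longlongrightarrow> 0) at_top"
      using assms by real_asymp
    have "(?G \<longlongrightarrow> 0) at_top"
      by (rule tendsto_eq_intros Lim_null_comparison[OF _ lim] | simp add: n)+
    then show "((?G \<circ> real_of_ereal) \<longlongrightarrow> 0) (at_left \<infinity>)"
      unfolding ereal_tendsto_simps .
    have "isCont ?G 0" by (intro continuous_intros) simp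
    then have "(?G \<longlongrightarrow> - 1 / (2 * \<beta>)) (at_right 0)"
      by (simp add: isCont_def filterlim_at_split)
    then show "((?G \<circ> real_of_ereal) \<longlongrightarrow> - 1 / (2 * \<beta>)) (at_right 0)"
      unfolding zero_ereal_def ereal_tendsto_simps .
  qed simp
  then have "(LBINT u. indicator {0..} u *\<^sub>R ?f u) = 1 / (2 * \<beta>)"
    unfolding ind by (simp add: interval_lebesgue_integral_def set_lebesgue_integral_def)
  then have "has_bochner_integral lborel (\<lambda>u. indicator {0..} u *\<^sub>R ?f u) (1 / (2 * \<beta>))"
    using integrable_mult_indicator[OF _ int, of "{0..}"] by (simp add: has_bochner_integral_iff)
  then have "has_bochner_integral lborel ?f (2 *\<^sub>R (1 / (2 * \<beta>)))"
    by (rule has_bochner_integral_even_function) simp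
  then show "(LBINT u. ?f u) = 1 / \<beta>"
    by (simp add: has_bochner_integral_iff scaleR_conv_of_real)
qed

lemma integral_abs_gaussian:
  fixes b :: real
  assumes "b > 0"
  shows "(LBINT u. \<bar>u\<bar> * exp (- b * u\<^sup>2)) = 1 / b"
proof -
  have "of_real (LBINT u. \<bar>u\<bar> * exp (- b * u\<^sup>2)) = (LBINT u. of_real \<bar>u\<bar> * exp (- of_real b * of_real (u\<^sup>2)) :: complex)"
    unfolding integral_complex_of_real[symmetric] by (simp add: exp_of_real[symmetric])
  also have "\<dots> = of_real (1 / b)"
    by (subst integral_abs_complex_gaussian) (use assms in auto)
  finally show ?thesis
    by (simp only: of_real_eq_iff)
qed

lemma ln_quotient_eq: "ln ((3 + 2 * sqrt 2) / (3 - 2 * sqrt 2)) = 4 * ln (1 + sqrt 2)"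
proof -
  have p: "1 + sqrt 2 > (0::real)"
    by (intro add_pos_pos) auto
  have "(3 + 2 * sqrt 2) * (3 - 2 * sqrt 2) = 1"
    by (simp add: algebra_simps)
  then have "inverse (3 + 2 * sqrt 2) = 3 - 2 * sqrt 2"
    by (rule inverse_unique)
  then have "(3 + 2 * sqrt 2) / (3 - 2 * sqrt 2) = (3 + 2 * sqrt 2) ^ 2"
    by (metis divide_inverse inverse_inverse_eq power2_eq_square)
  moreover have "3 + 2 * sqrt 2 = (1 + sqrt 2)\<^sup>2"
    by (simp add: power2_eq_square algebra_simps)
  then have "(3 + 2 * sqrt 2) ^ 2 = (1 + sqrt 2) ^ 4"
    by simp
  ultimately show ?thesis
    using p by (simp only: ln_realpow of_nat_numeral)
qed

text \<open>This is the source of the logarithm. The denominator factors as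
  \<open>(t\<^sup>2 + p) * (t\<^sup>2 + q)\<close> with p, q = 3 -/+ 2 sqrt 2, and partial fractions
  give a primitive on the half-line that tends to 0 at infinity. As pq = 1 and q = (1 + sqrt 2)^2,
  its value at 0 is a multiple of \<open>ln (1 + sqrt 2)\<close>.\<close>

lemma has_bochner_integral_inverse_quartic:
  "has_bochner_integral lborel (\<lambda>t. 4 * \<bar>t\<bar> / ((1 + t\<^sup>2)\<^sup>2 + 4 * t\<^sup>2)) (2 * sqrt 2 * ln (1 + sqrt 2))"
proof -
  define p q :: real where "p = 3 - 2 * sqrt 2" and "q = 3 + 2 * sqrt 2"
  have "sqrt 2 < 3 / 2"
    by (rule real_less_lsqrt) (auto simp: power2_eq_square)
  then have pq: "p > 0" "q > 0" "q - p = 4 * sqrt 2"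
    by (auto simp: p_def q_def add_pos_pos)
  have D: "(1 + t\<^sup>2)\<^sup>2 + 4 * t\<^sup>2 = (t\<^sup>2 + p) * (t\<^sup>2 + q)" for t
    by (simp add: p_def q_def power2_eq_square algebra_simps)
  let ?W = "\<lambda>t. (ln (t\<^sup>2 + p) - ln (t\<^sup>2 + q)) / (2 * sqrt 2)"
  have "(\<integral>\<^sup>+t. ennreal (4 * t / ((1 + t\<^sup>2)\<^sup>2 + 4 * t\<^sup>2)) * indicator {0..} t \<partial>lborel) = ennreal (0 - ?W 0)"
  proof (rule nn_integral_FTC_atLeast)
    fix t :: real assume t: "0 \<le> t"
    have pos: "t\<^sup>2 + p > 0" "t\<^sup>2 + q > 0"
      using pq by (auto intro: add_nonneg_pos)
    have "(?W has_real_derivative (2 * t / (t\<^sup>2 + p) - 2 * t / (t\<^sup>2 + q)) / (2 * sqrt 2)) (at t)"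
      using pos by (intro DERIV_cdivide DERIV_diff) (auto intro!: derivative_eq_intros)
    also have "(2 * t / (t\<^sup>2 + p) - 2 * t / (t\<^sup>2 + q)) / (2 * sqrt 2) = 4 * t / ((t\<^sup>2 + p) * (t\<^sup>2 + q))"
    proof -
      have "2 * t / (t\<^sup>2 + p) - 2 * t / (t\<^sup>2 + q) = 2 * t * (q - p) / ((t\<^sup>2 + p) * (t\<^sup>2 + q))"
        using pos by (simp add: divide_simps) (simp add: algebra_simps)
      then show ?thesis unfolding pq(3) using pos by (simp add: divide_simps)
    qed
    finally show "(?W has_real_derivative 4 * t / ((1 + t\<^sup>2)\<^sup>2 + 4 * t\<^sup>2)) (at t)"
      unfolding D .
    show "0 \<le> 4 * t / ((1 + t\<^sup>2)\<^sup>2 + 4 * t\<^sup>2)"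
      using t by simp
  next
    show "(?W \<longlongrightarrow> 0) at_top"
      using pq by real_asymp
  qed measurable
  also have "0 - ?W 0 = sqrt 2 * ln (1 + sqrt 2)"
  proof -
    have "ln q - ln p = 4 * ln (1 + sqrt 2)"
      using ln_quotient_eq pq by (simp add: ln_div p_def q_def)
    then show ?thesis
      by (simp add: field_simps)
  qed
  also have "(\<integral>\<^sup>+t. ennreal (4 * t / ((1 + t\<^sup>2)\<^sup>2 + 4 * t\<^sup>2)) * indicator {0..} t \<partial>lborel)
    = (\<integral>\<^sup>+t. ennreal (indicator {0..} t *\<^sub>R (4 * \<bar>t\<bar> / ((1 + t\<^sup>2)\<^sup>2 + 4 * t\<^sup>2))) \<partial>lborel)"
    by (intro nn_integral_cong) (simp split: split_indicator)
  finally have "has_bochner_integral lborel (\<lambda>t. indicator {0..} t *\<^sub>R (4 * \<bar>t\<bar> / ((1 + t\<^sup>2)\<^sup>2 + 4 * t\<^sup>2))) (sqrt 2 * ln (1 + sqrt 2))"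
    by (rule has_bochner_integral_nn_integral[rotated 3]) (auto split: split_indicator)
  then have "has_bochner_integral lborel (\<lambda>t. 4 * \<bar>t\<bar> / ((1 + t\<^sup>2)\<^sup>2 + 4 * t\<^sup>2)) (2 *\<^sub>R (sqrt 2 * ln (1 + sqrt 2)))"
    by (rule has_bochner_integral_even_function) simp
  then show ?thesis by (simp add: mult.assoc)
qed

lemma sg_minus: "x \<noteq> 0 \<Longrightarrow> sg (- x) = - sg x"
  by (simp add: sg_def)

text \<open>For u and t nonzero, the substitution \<open>v = u * t\<close> turns the product of
  signs into \<open>sg t\<close>, independent of u. After exchanging the integrals, the one over u
  equals \<open>1 / \<beta>\<close> for a complex \<beta> depending on t. The real part of the
  remaining integrand is odd in t and the imaginary part is the rational function just
  integrated.\<close>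

lemma sign_kernel_0_0: "sign_kernel 0 0 = \<i> * of_real (2 * sqrt 2 * ln (1 + sqrt 2))"
proof -
  let ?\<beta> = "\<lambda>t. of_real ((1 + t\<^sup>2) / 2) - \<i> * of_real t"
  let ?k = "\<lambda>t u. of_real (sg t) * (of_real \<bar>u\<bar> * exp (- ?\<beta> t * of_real (u\<^sup>2)))"
  let ?D = "\<lambda>t :: real. (1 + t\<^sup>2)\<^sup>2 + 4 * t\<^sup>2"
  have inv_int: "integrable lborel (\<lambda>t :: real. 2 * inverse (1 + t\<^sup>2))"
    using integrable_inverse_1_plus_square by (simp add: set_integrable_def)
  have pos: "1 + t\<^sup>2 > 0" for t :: real
    by (simp add: add_pos_nonneg)
  have D_pos: "?D t > 0" for t
    using zero_less_power[OF pos[of t], of 2] by (simp add: add_pos_nonneg)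
  have Re: "Re (?\<beta> t) > 0" for t :: real
    by (simp add: add_pos_nonneg)
  have inner: "(LBINT v. of_real (sg u * sg v * gauss u * gauss v) * cis (u * v)) = (LBINT t. ?k t u)" if "u \<noteq> 0" for u
  proof -
    have "(LBINT v. of_real (sg u * sg v * gauss u * gauss v) * cis (u * v))
      = (LBINT t. \<bar>u\<bar> *\<^sub>R (of_real (sg u * sg (u * t) * gauss u * gauss (u * t)) * cis (u * (u * t))))"
      using lborel_integral_real_affine[OF that, of "\<lambda>v. of_real (sg u * sg v * gauss u * gauss v) * cis (u * v)" 0]
      by simp
    also have "\<dots> = (LBINT t. ?k t u)"
    proof (rule integral_cong_AE)
      show "AE t in lborel. \<bar>u\<bar> *\<^sub>R (of_real (sg u * sg (u * t) * gauss u * gauss (u * t)) * cis (u * (u * t))) = ?k t u"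
        using AE_lborel_singleton[of 0]
      proof eventually_elim
        case (elim t)
        then have "sg u * sg (u * t) = sg t"
          using that by (auto simp: sg_def zero_le_mult_iff)
        moreover have "of_real (gauss u * gauss (u * t)) * cis (u * (u * t)) = exp (- ?\<beta> t * of_real (u\<^sup>2))"
        proof -
          have "- ?\<beta> t * of_real (u\<^sup>2) = of_real (- u\<^sup>2 / 2 + - (u * t)\<^sup>2 / 2) + \<i> * of_real (u * (u * t))"
            by (simp add: complex_eq_iff power2_eq_square field_simps)
          then show ?thesis
            by (simp only: exp_add exp_of_real cis_conv_exp gauss_def of_real_mult)
        qed
        moreover have "\<bar>u\<bar> *\<^sub>R (of_real (sg u * sg (u * t) * gauss u * gauss (u * t)) * cis (u * (u * t)))
          = of_real (sg u * sg (u * t)) * (of_real \<bar>u\<bar> * (of_real (gauss u * gauss (u * t)) * cis (u * (u * t))))"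
          by (simp add: scaleR_conv_of_real mult_ac)
        ultimately show ?case
          by simp
      qed
    qed (simp_all)
    finally show ?thesis .
  qed
  have k_int: "integrable lborel (case_prod ?k)"
  proof -
    have "integrable (lborel \<Otimes>\<^sub>M lborel) (case_prod ?k)"
    proof (rule lborel_pair.Fubini_integrable)
      show "case_prod ?k \<in> borel_measurable (lborel \<Otimes>\<^sub>M lborel)"
        by measurable
      \<comment> \<open>Taking norms replaces \<beta> by its real part, which grows quadratically in
        t; this decay gives the absolute integrability that Fubini needs.\<close>
      have "(LBINT u. norm (?k t u)) = 2 * inverse (1 + t\<^sup>2)" for t
        using integral_abs_gaussian[of "(1 + t\<^sup>2) / 2"] by (simp add: norm_mult norm_exp_eq_Re add_pos_nonneg field_simps)
      moreover have "integrable lborel (\<lambda>t :: real. 2 * inverse (1 + t\<^sup>2))"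
        by (rule inv_int)
      ultimately show "integrable lborel (\<lambda>t. LBINT u. norm (case (t, u) of (t, u) \<Rightarrow> ?k t u))"
        by simp
      show "AE t in lborel. integrable lborel (\<lambda>u. case (t, u) of (t, u) \<Rightarrow> ?k t u)"
        using integrable_abs_complex_gaussian[OF Re] by simp
    qed
    then show ?thesis by (simp add: lborel_prod)
  qed
  have "sign_kernel 0 0 = (LBINT u. LBINT t. ?k t u)"
    unfolding sign_kernel_def
  proof (rule integral_cong_AE)
    show "AE u in lborel. (LBINT v. of_real (sg (u - 0) * sg (v - 0) * gauss u * gauss v) * cis (u * v)) = (LBINT t. ?k t u)"
      using AE_lborel_singleton[of 0] by eventually_elim (unfold diff_zero, rule inner)
    show "(\<lambda>u. LBINT t. ?k t u) \<in> borel_measurable lborel"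
      by measurable
  qed measurable
  also have "\<dots> = (LBINT t. LBINT u. ?k t u)"
    by (simp only: lborel_integral_fst[OF k_int] lborel_integral_snd[OF k_int])
  also have "\<dots> = (LBINT t. of_real (sg t) * (1 / ?\<beta> t))"
    unfolding integral_mult_right_zero integral_abs_complex_gaussian[OF Re] ..
  also have "\<dots> = (LBINT t. of_real (2 * sg t * (1 + t\<^sup>2) / ((1 + t\<^sup>2)\<^sup>2 + 4 * t\<^sup>2)) + \<i> * of_real (4 * \<bar>t\<bar> / ((1 + t\<^sup>2)\<^sup>2 + 4 * t\<^sup>2)))"
  proof (intro Bochner_Integration.integral_cong refl)
    fix t
    \<comment> \<open>The squared modulus of \<beta> is \<open>?D t / 4\<close>, so the second
      factor is the conjugate of \<beta> divided by it.\<close>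
    have "?\<beta> t * (of_real (2 * (1 + t\<^sup>2) / ?D t) + \<i> * of_real (4 * t / ?D t)) = 1"
      using D_pos[of t] by (simp add: complex_eq_iff add_divide_distrib[symmetric]) (simp add: power2_eq_square algebra_simps)
    then have *: "1 / ?\<beta> t = of_real (2 * (1 + t\<^sup>2) / ?D t) + \<i> * of_real (4 * t / ?D t)"
      using inverse_unique by (metis inverse_eq_divide)
    show "of_real (sg t) * (1 / ?\<beta> t) = of_real (2 * sg t * (1 + t\<^sup>2) / ?D t) + \<i> * of_real (4 * \<bar>t\<bar> / ?D t)"
    proof -
      have "2 * sg t * (1 + t\<^sup>2) / ?D t = sg t * (2 * (1 + t\<^sup>2) / ?D t)" "4 * \<bar>t\<bar> / ?D t = sg t * (4 * t / ?D t)"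
        by (simp_all add: sg_def)
      with * show ?thesis
        by (simp only: of_real_mult distrib_left mult.left_commute)
    qed
  qed
  also have "\<dots> = of_real (LBINT t. 2 * sg t * (1 + t\<^sup>2) / ((1 + t\<^sup>2)\<^sup>2 + 4 * t\<^sup>2)) + \<i> * of_real (LBINT t. 4 * \<bar>t\<bar> / ((1 + t\<^sup>2)\<^sup>2 + 4 * t\<^sup>2))"
  proof -
    have "integrable lborel (\<lambda>t. 2 * sg t * (1 + t\<^sup>2) / ?D t)"
    proof (rule Bochner_Integration.integrable_bound)
      show "integrable lborel (\<lambda>t :: real. 2 * inverse (1 + t\<^sup>2))"
        by (rule inv_int)
      show "AE t in lborel. norm (2 * sg t * (1 + t\<^sup>2) / ?D t) \<le> norm (2 * inverse (1 + t\<^sup>2))"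
      proof (intro AE_I2)
        fix t :: real
        have le: "(1 + t\<^sup>2) / ?D t \<le> (1 + t\<^sup>2) / (1 + t\<^sup>2)\<^sup>2"
          using D_pos[of t] pos[of t] by (intro divide_left_mono mult_pos_pos) auto
        show "norm (2 * sg t * (1 + t\<^sup>2) / ?D t) \<le> norm (2 * inverse (1 + t\<^sup>2))"
        proof -
          have "(1 + t\<^sup>2) / (1 + t\<^sup>2)\<^sup>2 = inverse (1 + t\<^sup>2)"
            using pos[of t] by (simp add: power2_eq_square divide_inverse)
          moreover have "norm (2 * sg t * (1 + t\<^sup>2) / ?D t) = 2 * ((1 + t\<^sup>2) / ?D t)"
            using pos[of t] D_pos[of t] by (simp only: real_norm_def abs_mult abs_divide abs_sg abs_of_pos)
          moreover have "norm (2 * inverse (1 + t\<^sup>2)) = 2 * inverse (1 + t\<^sup>2)"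
            using pos[of t] by simp
          ultimately show ?thesis
            using mult_left_mono[OF le, of 2] by (simp only: zero_le_numeral)
        qed
      qed
    qed simp
    moreover have "integrable lborel (\<lambda>t. 4 * \<bar>t\<bar> / ?D t)"
      using has_bochner_integral_inverse_quartic by (simp add: has_bochner_integral_iff)
    ultimately show ?thesis
      by (simp only: Bochner_Integration.integral_add integral_mult_right_zero integral_complex_of_real
        integrable_mult_right integrable_of_real)
  qed
  also have "(LBINT t. 4 * \<bar>t\<bar> / ((1 + t\<^sup>2)\<^sup>2 + 4 * t\<^sup>2)) = 2 * sqrt 2 * ln (1 + sqrt 2)"
    using has_bochner_integral_inverse_quartic by (simp add: has_bochner_integral_iff)
  also have "(LBINT t. 2 * sg t * (1 + t\<^sup>2) / ((1 + t\<^sup>2)\<^sup>2 + 4 * t\<^sup>2)) = 0"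
    by (rule integral_odd_eq_0) (auto simp: sg_minus)
  finally show ?thesis by simp
qed

subsection \<open>Gaussian moments and Fourier transforms of polynomials\<close>

text \<open>
  The lists hold the coefficients of a polynomial, from degree \<open>k\<close> upwards. The moments, for the weight
  \<open>exp (- x\<^sup>2)\<close>, are in units of \<open>sqrt \<pi>\<close>, and the Fourier transforms in units of \<open>sqrt (2 \<pi>) g x\<close>.
\<close>
primrec gauss_moment_list :: "nat \<Rightarrow> real list \<Rightarrow> real" where
  "gauss_moment_list k [] = 0"
| "gauss_moment_list k (a # as) = (if even k then a * (fact k / (2 ^ k * fact (k div 2))) else 0) + gauss_moment_list (Suc k) as"

primrec fourier_list :: "nat \<Rightarrow> real list \<Rightarrow> real \<Rightarrow> complex" where
  "fourier_list k [] x = 0"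
| "fourier_list k (a # as) x = of_real a * fourier_poly k x + fourier_list (Suc k) as x"

lemma gauss_square: "gauss x * gauss x = exp (- x\<^sup>2)"
  by (simp add: gauss_def flip: exp_add)

text \<open>The factor \<open>x ^ k\<close> records the degree offset, so an induction on the
  coefficients can split off the lowest one and continue with \<open>Suc k\<close>.\<close>

lemma integrable_gauss_poly_shift: "integrable lborel (\<lambda>x. gauss x * (x ^ k * poly p x))"
proof (induction p arbitrary: k)
  case (pCons a p)
  have "gauss x * (x ^ k * poly (pCons a p) x) = a * (gauss x * x ^ k) + gauss x * (x ^ Suc k * poly p x)" for x
    by (simp add: algebra_simps)
  then show ?case
    using pCons.IH[of "Suc k"] integrable_gauss_power[of k] by (simp del: power_Suc)
qed simp

lemma integrable_gauss_poly: "integrable lborel (\<lambda>x. gauss x * poly p x)"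
  using integrable_gauss_poly_shift[of 0 p] by simp

lemma integral_gauss_poly_cis:
  "(LBINT y. of_real (gauss y * (y ^ k * poly (Poly as) y)) * cis (x * y))
    = of_real (sqrt (2 * pi) * gauss x) * fourier_list k as x"
proof (induction as arbitrary: k)
  case (Cons a as)
  have "of_real (gauss y * (y ^ k * poly (Poly (a # as)) y)) * cis (x * y)
    = of_real a * (of_real (gauss y * y ^ k) * cis (x * y)) + of_real (gauss y * (y ^ Suc k * poly (Poly as) y)) * cis (x * y)" for y
    by (simp add: algebra_simps)
  then have "(LBINT y. of_real (gauss y * (y ^ k * poly (Poly (a # as)) y)) * cis (x * y))
    = of_real a * (LBINT y. of_real (gauss y * y ^ k) * cis (x * y))
      + (LBINT y. of_real (gauss y * (y ^ Suc k * poly (Poly as) y)) * cis (x * y))"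
    by (simp only: integral_mult_right_zero Bochner_Integration.integral_add integrable_mult_right
      integrable_mult_cis integrable_gauss_power integrable_gauss_poly_shift)
  then show ?case
    unfolding Cons.IH integral_gauss_power_cis by (simp add: algebra_simps)
qed simp

lemma has_bochner_integral_gauss_moment:
  "has_bochner_integral lborel (\<lambda>x. exp (- x\<^sup>2) * x ^ k) (if even k then sqrt pi * (fact k / (2 ^ k * fact (k div 2))) else 0)"
proof (cases "even k")
  case True
  then obtain m where "k = 2 * m" by (elim evenE)
  then show ?thesis
    using has_bochner_integral_even_function[OF gaussian_moment_even_pos[of m]] by simp
next
  case False
  then obtain m where k: "k = 2 * m + 1" by (elim oddE)
  show ?thesis
    using has_bochner_integral_odd_function[OF gaussian_moment_odd_pos[of m]] k by simp
qed

lemma has_bochner_integral_gauss_moment_list: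
  "has_bochner_integral lborel (\<lambda>x. exp (- x\<^sup>2) * (x ^ k * poly (Poly as) x)) (sqrt pi * gauss_moment_list k as)"
proof (induction as arbitrary: k)
  case (Cons a as)
  have "has_bochner_integral lborel (\<lambda>x. a * (exp (- x\<^sup>2) * x ^ k) + exp (- x\<^sup>2) * (x ^ Suc k * poly (Poly as) x))
    (a * (if even k then sqrt pi * (fact k / (2 ^ k * fact (k div 2))) else 0) + sqrt pi * gauss_moment_list (Suc k) as)"
    by (intro has_bochner_integral_add has_bochner_integral_mult_right has_bochner_integral_gauss_moment Cons)
  then show ?case
    by (cases "even k") (simp_all add: algebra_simps)
qed (simp add: has_bochner_integral_zero)

section \<open>Coefficient lists for the numerator of \<open>h5\<close> and its powers\<close>

definition h5_numer :: "real list" where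
  "h5_numer = [0, 15, 0, - 20, 0, 4]"

lemma h5_numer: "poly (Poly h5_numer) x = 4 * x ^ 5 - 20 * x ^ 3 + 15 * x"
  by (simp add: h5_numer_def eval_nat_numeral algebra_simps)

text \<open>Degree 10 is reached because the square of the degree 5 numerator must be transformed as
  well.\<close>

lemma fourier_poly_values:
  "fourier_poly 2 x = of_real (1 - x\<^sup>2)"
  "fourier_poly 3 x = \<i> * of_real (3 * x - x ^ 3)"
  "fourier_poly 4 x = of_real (3 - 6 * x\<^sup>2 + x ^ 4)"
  "fourier_poly 5 x = \<i> * of_real (15 * x - 10 * x ^ 3 + x ^ 5)"
  "fourier_poly 6 x = of_real (15 - 45 * x\<^sup>2 + 15 * x ^ 4 - x ^ 6)"
  "fourier_poly 7 x = \<i> * of_real (105 * x - 105 * x ^ 3 + 21 * x ^ 5 - x ^ 7)"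
  "fourier_poly 8 x = of_real (105 - 420 * x\<^sup>2 + 210 * x ^ 4 - 28 * x ^ 6 + x ^ 8)"
  "fourier_poly 9 x = \<i> * of_real (945 * x - 1260 * x ^ 3 + 378 * x ^ 5 - 36 * x ^ 7 + x ^ 9)"
  "fourier_poly 10 x = of_real (945 - 4725 * x\<^sup>2 + 3150 * x ^ 4 - 630 * x ^ 6 + 45 * x ^ 8 - x ^ 10)"
proof -
  have rec: "fourier_poly n x = \<i> * of_real x * fourier_poly (n - 1) x + of_nat (n - 1) * fourier_poly (n - 2) x" if "n \<ge> 2" for n
  proof -
    from that obtain m where "n = Suc (Suc m)"
      by (metis Suc_le_D numeral_2_eq_2 Suc_le_mono)
    then show ?thesis by simp
  qed
  have 1: "fourier_poly 1 x = \<i> * of_real x" by simp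
  show 2: "fourier_poly 2 x = of_real (1 - x\<^sup>2)"
    by (simp add: rec[of 2] power2_eq_square complex_eq_iff)
  show 3: "fourier_poly 3 x = \<i> * of_real (3 * x - x ^ 3)"
    by (simp add: rec[of 3] 2 eval_nat_numeral complex_eq_iff algebra_simps)
  show 4: "fourier_poly 4 x = of_real (3 - 6 * x\<^sup>2 + x ^ 4)"
    using 2 3 by (simp add: rec[of 4] complex_eq_iff eval_nat_numeral algebra_simps)
  show 5: "fourier_poly 5 x = \<i> * of_real (15 * x - 10 * x ^ 3 + x ^ 5)"
    using 3 4 by (simp add: rec[of 5] complex_eq_iff eval_nat_numeral algebra_simps)
  show 6: "fourier_poly 6 x = of_real (15 - 45 * x\<^sup>2 + 15 * x ^ 4 - x ^ 6)"
    using 4 5 by (simp add: rec[of 6] complex_eq_iff eval_nat_numeral algebra_simps)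
  show 7: "fourier_poly 7 x = \<i> * of_real (105 * x - 105 * x ^ 3 + 21 * x ^ 5 - x ^ 7)"
    using 5 6 by (simp add: rec[of 7] complex_eq_iff eval_nat_numeral algebra_simps)
  show 8: "fourier_poly 8 x = of_real (105 - 420 * x\<^sup>2 + 210 * x ^ 4 - 28 * x ^ 6 + x ^ 8)"
    using 6 7 by (simp add: rec[of 8] complex_eq_iff eval_nat_numeral algebra_simps)
  show 9: "fourier_poly 9 x = \<i> * of_real (945 * x - 1260 * x ^ 3 + 378 * x ^ 5 - 36 * x ^ 7 + x ^ 9)"
    using 7 8 by (simp add: rec[of 9] complex_eq_iff eval_nat_numeral algebra_simps)
  show 10: "fourier_poly 10 x = of_real (945 - 4725 * x\<^sup>2 + 3150 * x ^ 4 - 630 * x ^ 6 + 45 * x ^ 8 - x ^ 10)"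
    using 8 9 by (simp add: rec[of 10] complex_eq_iff eval_nat_numeral algebra_simps)
qed

definition h5_numer_square :: "real list" where
  "h5_numer_square = [0, 0, 225, 0, - 600, 0, 520, 0, - 160, 0, 16]"

text \<open>Obtained by replacing each monomial of \<open>h5_numer_square\<close> by its
  \<open>fourier_poly\<close>; all degrees are even, so the result is real.\<close>

definition h5_numer_square_fourier :: "real list" where
  "h5_numer_square_fourier = [4545, 0, - 28425, 0, 24000, 0, - 6120, 0, 560, 0, - 16]"

lemma h5_numer_square: "poly (Poly h5_numer_square) x = poly (Poly h5_numer) x ^ 2"
  by (simp add: h5_numer_square_def h5_numer_def power2_eq_square algebra_simps)

text \<open>The eigenfunction property of the fifth Hermite function, with eigenvalue
  \<open>\<i> ^ 5 = \<i>\<close>.\<close>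

lemma fourier_h5_numer: "fourier_list 0 h5_numer x = \<i> * of_real (poly (Poly h5_numer) x)"
  unfolding h5_numer by (simp add: h5_numer_def fourier_poly_values complex_eq_iff del: fourier_poly.simps(3) flip: numeral_2_eq_2)

lemma fourier_h5_numer_square: "fourier_list 0 h5_numer_square x = of_real (poly (Poly h5_numer_square_fourier) x)"
  by (simp add: h5_numer_square_def h5_numer_square_fourier_def fourier_poly_values complex_eq_iff del: fourier_poly.simps(3) flip: numeral_2_eq_2)
    (simp add: eval_nat_numeral algebra_simps)

text \<open>The same 60 as in \<open>h5_denom_square\<close>: together they say that
  \<open>h5\<close> has unit norm.\<close>

lemma moment_h5_numer_square: "gauss_moment_list 0 h5_numer_square = 60"
  by (simp add: h5_numer_square_def fact_numeral flip: numeral_2_eq_2)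

definition h5_numer_fourth :: "real list" where
  "h5_numer_fourth = [0, 0, 0, 0, 50625, 0, - 270000, 0, 594000, 0, - 696000, 0, 469600, 0, - 185600, 0, 42240, 0, - 5120, 0, 256]"

text \<open>The square times the transform of the square. This is what the monomial of degree two in
  each kernel variable leaves once y has been integrated out.\<close>

definition h5_numer_mixed :: "real list" where
  "h5_numer_mixed = [0, 0, 1022625, 0, - 9122625, 0, 24818400, 0, - 31285200, 0, 20898720, 0, - 7816800, 0, 1664000, 0, - 195840, 0, 11520, 0, - 256]"

lemma h5_numer_fourth: "poly (Poly h5_numer_fourth) x = poly (Poly h5_numer) x ^ 4"
proof -
  have "Poly h5_numer_fourth = Poly h5_numer_square * Poly h5_numer_square"
    by (simp add: h5_numer_fourth_def h5_numer_square_def)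
  then show ?thesis
    by (simp add: h5_numer_square flip: power_add)
qed

lemma h5_numer_mixed: "poly (Poly h5_numer_mixed) x = poly (Poly h5_numer) x ^ 2 * poly (Poly h5_numer_square_fourier) x"
proof -
  have "Poly h5_numer_mixed = Poly h5_numer_square * Poly h5_numer_square_fourier"
    by (simp add: h5_numer_mixed_def h5_numer_square_def h5_numer_square_fourier_def)
  then show ?thesis
    by (simp add: h5_numer_square)
qed

lemma moment_h5_numer_fourth: "gauss_moment_list 0 h5_numer_fourth = 16750800"
  by (simp add: h5_numer_fourth_def fact_numeral flip: numeral_2_eq_2)

lemma moment_h5_numer_mixed: "gauss_moment_list 0 h5_numer_mixed = 176400"
  by (simp add: h5_numer_mixed_def fact_numeral flip: numeral_2_eq_2)

subsection \<open>Integrals of the fifth Hermite polynomial\<close>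

lemma sign_kernel_bound: "norm (sign_kernel a b) \<le> 2 * pi"
proof -
  have inner: "norm (LBINT v. of_real (sg (u - a) * sg (v - b) * gauss u * gauss v) * cis (u * v)) \<le> sqrt (2 * pi) * gauss u" for u
  proof -
    have "norm (LBINT v. of_real (sg (u - a) * sg (v - b) * gauss u * gauss v) * cis (u * v)) \<le> (LBINT v. gauss u * gauss v)"
      by (intro norm_integral_le integrable_mult_right integrable_gauss) (simp add: norm_mult abs_mult)
    then show ?thesis by (simp add: integral_gauss mult.commute)
  qed
  have "norm (sign_kernel a b) \<le> (LBINT u. sqrt (2 * pi) * gauss u)"
    unfolding sign_kernel_def by (intro norm_integral_le integrable_mult_right integrable_gauss inner)
  also have "\<dots> = 2 * pi"
    by (simp add: integral_gauss)
  finally show ?thesis .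
qed

text \<open>Reflecting u negates the first sign, except at \<open>u = a\<close>, and conjugates
  \<open>cis (u * v)\<close>, while \<open>gauss\<close> is even and all other factors are real.
  This symmetry later makes the real part of \<open>H_eta\<close> vanish.\<close>

lemma sign_kernel_minus_left: "sign_kernel (- a) b = - cnj (sign_kernel a b)"
proof -
  let ?k = "\<lambda>u v. of_real (sg (u - a) * sg (v - b) * gauss u * gauss v) * cis (u * v)"
  have [measurable]: "cnj \<in> borel_measurable borel"
    by (intro borel_measurable_continuous_onI continuous_intros)
  have "sign_kernel (- a) b = (LBINT u. LBINT v. of_real (sg (- u + a) * sg (v - b) * gauss (- u) * gauss v) * cis (- u * v))"
    using lborel_integral_real_affine[of "- 1" "\<lambda>u. LBINT v. of_real (sg (u - - a) * sg (v - b) * gauss u * gauss v) * cis (u * v)" 0]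
    by (simp add: sign_kernel_def)
  also have "\<dots> = (LBINT u. - cnj (LBINT v. ?k u v))"
  proof (rule integral_cong_AE)
    show "AE u in lborel. (LBINT v. of_real (sg (- u + a) * sg (v - b) * gauss (- u) * gauss v) * cis (- u * v)) = - cnj (LBINT v. ?k u v)"
      using AE_lborel_singleton[of a]
    proof eventually_elim
      case (elim u)
      then have "sg (- u + a) = - sg (u - a)"
        by (auto simp: sg_def)
      then have "of_real (sg (- u + a) * sg (v - b) * gauss (- u) * gauss v) * cis (- u * v) = - cnj (?k u v)" for v
        by (simp add: cis_cnj)
      then show ?case
        by (simp only: Bochner_Integration.integral_minus Bochner_Integration.integral_cnj)
    qed
  qed measurable
  also have "\<dots> = - cnj (sign_kernel a b)"
    unfolding sign_kernel_def by (simp only: Bochner_Integration.integral_minus Bochner_Integration.integral_cnj)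
  finally show ?thesis .
qed

lemma sign_kernel_measurable: "(\<lambda>p. sign_kernel (fst p) (snd p)) \<in> borel_measurable (borel \<Otimes>\<^sub>M borel)"
  unfolding sign_kernel_def by measurable

section \<open>Normalized Fourier transforms and moments of \<open>h5\<close>\<close>

definition h5_denom :: real where
  "h5_denom = 2 * root 4 pi * sqrt 15"

lemma h5_denom_square: "h5_denom ^ 2 = 60 * sqrt pi"
proof -
  have "root 4 pi ^ 2 = sqrt pi"
  proof -
    have "root 4 pi = sqrt (sqrt pi)"
      using real_root_mult_exp[of 2 2 pi] by (simp add: sqrt_def)
    then show ?thesis by simp
  qed
  then show ?thesis
    by (simp add: h5_denom_def power_mult_distrib)
qed

lemma h5_denom_fourth: "h5_denom ^ 4 = 3600 * pi"
proof -
  have "h5_denom ^ 4 = (h5_denom ^ 2) ^ 2"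
    by (simp flip: power_mult)
  then show ?thesis
    by (simp add: h5_denom_square power_mult_distrib)
qed

lemma h5_denom_fourth_coeff: "sqrt pi * c / h5_denom ^ 4 = c / (3600 * sqrt pi)"
proof -
  have "sqrt pi / pi = 1 / sqrt pi"
    by (simp add: field_simps)
  then show ?thesis
    unfolding h5_denom_fourth by (metis (no_types) mult.commute times_divide_times_eq mult_1)
qed

definition h5_poly :: "real poly" where
  "h5_poly = smult (1 / h5_denom) (Poly h5_numer)"

lemma h5_eq: "h5 x = poly (Poly h5_numer) x / h5_denom"
  unfolding h5_numer by (simp add: h5_def h5_denom_def)

lemma h5_eq_poly: "h5 x = poly h5_poly x"
  by (simp add: h5_eq h5_poly_def)

lemma h5_minus: "h5 (- x) = - h5 x"
  unfolding h5_def by (simp add: field_simps)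

lemma integrable_gauss_h5_power: "integrable lborel (\<lambda>x. gauss x * h5 x ^ k)"
  using integrable_gauss_poly[of "h5_poly ^ k"] by (simp add: h5_eq_poly)

lemma fourier_one: "(LBINT y. of_real (gauss y * h5 y ^ 0) * cis (x * y)) = of_real (sqrt (2 * pi) * gauss x)"
  using integral_gauss_cis[of x] by simp

lemma fourier_h5: "(LBINT y. of_real (gauss y * h5 y ^ 1) * cis (x * y)) = of_real (sqrt (2 * pi) * gauss x) * (\<i> * of_real (h5 x))"
proof -
  have "of_real (gauss y * h5 y ^ 1) * cis (x * y) = of_real (1 / h5_denom) * (of_real (gauss y * (y ^ 0 * poly (Poly h5_numer) y)) * cis (x * y))" for y
    by (simp add: h5_eq)
  then show ?thesis
    by (simp only: integral_mult_right_zero integral_gauss_poly_cis fourier_h5_numer h5_eq) simp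
qed

lemma fourier_h5_square: "(LBINT y. of_real (gauss y * h5 y ^ 2) * cis (x * y))
  = of_real (sqrt (2 * pi) * gauss x) * of_real (poly (Poly h5_numer_square_fourier) x / h5_denom ^ 2)"
proof -
  have "of_real (gauss y * h5 y ^ 2) * cis (x * y) = of_real (1 / h5_denom ^ 2) * (of_real (gauss y * (y ^ 0 * poly (Poly h5_numer_square) y)) * cis (x * y))" for y
    by (simp add: h5_eq h5_numer_square power_divide)
  then show ?thesis
    by (simp only: integral_mult_right_zero integral_gauss_poly_cis fourier_h5_numer_square) simp
qed

lemma has_bochner_integral_h5_square: "has_bochner_integral lborel (\<lambda>x. gauss x * gauss x * h5 x ^ 2) 1"
proof -
  have "has_bochner_integral lborel (\<lambda>x. 1 / h5_denom ^ 2 * (exp (- x\<^sup>2) * (x ^ 0 * poly (Poly h5_numer_square) x))) (1 / h5_denom ^ 2 * (sqrt pi * 60))"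
    by (intro has_bochner_integral_mult_right) (use has_bochner_integral_gauss_moment_list[of 0 h5_numer_square] moment_h5_numer_square in simp)
  then show ?thesis
    by (simp add: h5_eq h5_numer_square gauss_square power_divide h5_denom_square)
qed

lemma has_bochner_integral_h5_fourth: "has_bochner_integral lborel (\<lambda>x. gauss x * gauss x * h5 x ^ 4) (16750800 / (3600 * sqrt pi))"
proof -
  have "has_bochner_integral lborel (\<lambda>x. 1 / h5_denom ^ 4 * (exp (- x\<^sup>2) * (x ^ 0 * poly (Poly h5_numer_fourth) x))) (1 / h5_denom ^ 4 * (sqrt pi * 16750800))"
    by (intro has_bochner_integral_mult_right) (use has_bochner_integral_gauss_moment_list[of 0 h5_numer_fourth] moment_h5_numer_fourth in simp)
  then show ?thesis
    by (simp add: h5_eq h5_numer_fourth gauss_square power_divide h5_denom_fourth_coeff)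
qed

lemma has_bochner_integral_h5_mixed: "has_bochner_integral lborel (\<lambda>x. gauss x * gauss x * (h5 x ^ 2 * (poly (Poly h5_numer_square_fourier) x / h5_denom ^ 2))) (176400 / (3600 * sqrt pi))"
proof -
  have "has_bochner_integral lborel (\<lambda>x. 1 / h5_denom ^ 4 * (exp (- x\<^sup>2) * (x ^ 0 * poly (Poly h5_numer_mixed) x))) (1 / h5_denom ^ 4 * (sqrt pi * 176400))"
    by (intro has_bochner_integral_mult_right) (use has_bochner_integral_gauss_moment_list[of 0 h5_numer_mixed] moment_h5_numer_mixed in simp)
  moreover have "exp (- x\<^sup>2) * (h5 x ^ 2 * (poly (Poly h5_numer_square_fourier) x / h5_denom ^ 2))
    = 1 / h5_denom ^ 4 * (exp (- x\<^sup>2) * (x ^ 0 * poly (Poly h5_numer_mixed) x))" for x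
    by (simp add: h5_eq h5_numer_mixed power_divide flip: power_add)
  ultimately show ?thesis
    by (simp add: gauss_square h5_denom_fourth_coeff)
qed

subsection \<open>The expansion of the planar integral\<close>

text \<open>The density belonging to the monomial a^m b^n of the Taylor polynomial at
  \<open>a = \<eta> * h5 x\<close> and \<open>b = \<eta> * h5 y\<close>, without the power of
  \<open>\<eta>\<close>.\<close>

definition h5_wave :: "nat \<Rightarrow> nat \<Rightarrow> real \<Rightarrow> real \<Rightarrow> complex" where
  "h5_wave m n x y = of_real (gauss x * h5 x ^ m * (gauss y * h5 y ^ n)) * cis (x * y)"

lemma integrable_h5_wave: "integrable lborel (case_prod (h5_wave m n))"
proof (rule Bochner_Integration.integrable_bound)
  show "integrable lborel (\<lambda>(x, y). (gauss x * h5 x ^ m) * (gauss y * h5 y ^ n))"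
    by (intro integrable_lborel_mult_prod integrable_gauss_h5_power)
  have "case_prod (h5_wave m n) \<in> borel_measurable (borel \<Otimes>\<^sub>M borel)"
    unfolding h5_wave_def by measurable
  then show "case_prod (h5_wave m n) \<in> borel_measurable lborel"
    by (simp add: borel_prod)
  show "AE p in lborel. norm (case_prod (h5_wave m n) p) \<le> norm (case p of (x, y) \<Rightarrow> (gauss x * h5 x ^ m) * (gauss y * h5 y ^ n))"
    by (auto simp: h5_wave_def norm_mult abs_mult power_abs norm_power)
qed

lemma h5_wave_integral_commute: "(LINT p|lborel. case_prod (h5_wave m n) p) = (LINT p|lborel. case_prod (h5_wave n m) p)"
proof -
  have "(LINT p|lborel. case_prod (h5_wave m n) p) = (LBINT y. LBINT x. h5_wave m n x y)"
    by (rule lborel_integral_snd[OF integrable_h5_wave, symmetric])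
  also have "\<dots> = (LBINT y. LBINT x. h5_wave n m y x)"
    by (simp add: h5_wave_def mult_ac)
  also have "\<dots> = (LINT p|lborel. case_prod (h5_wave n m) p)"
    by (rule lborel_integral_fst[OF integrable_h5_wave])
  finally show ?thesis .
qed

text \<open>The Fourier transform in y contributes a second factor \<open>gauss x\<close>, so a
  plain moment for the weight \<open>exp (- x\<^sup>2)\<close> remains.\<close>

lemma h5_wave_integral:
  assumes fourier: "\<And>x. (LBINT y. of_real (gauss y * h5 y ^ n) * cis (x * y)) = of_real (sqrt (2 * pi) * gauss x) * (c * of_real (r x))"
    and mean: "has_bochner_integral lborel (\<lambda>x. gauss x * gauss x * (h5 x ^ m * r x)) I"
  shows "(LINT p|lborel. case_prod (h5_wave m n) p) = of_real (sqrt (2 * pi)) * c * of_real I"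
proof -
  have "(LINT p|lborel. case_prod (h5_wave m n) p) = (LBINT x. LBINT y. h5_wave m n x y)"
    by (rule lborel_integral_fst[OF integrable_h5_wave, symmetric])
  also have "\<dots> = (LBINT x. of_real (gauss x * h5 x ^ m) * (LBINT y. of_real (gauss y * h5 y ^ n) * cis (x * y)))"
    unfolding integral_mult_right_zero[symmetric] h5_wave_def
    by (intro Bochner_Integration.integral_cong refl) (simp add: mult_ac)
  also have "\<dots> = (LBINT x. of_real (sqrt (2 * pi)) * c * of_real (gauss x * gauss x * (h5 x ^ m * r x)))"
    unfolding fourier by (intro Bochner_Integration.integral_cong refl) (simp add: mult_ac)
  also have "\<dots> = of_real (sqrt (2 * pi)) * c * of_real I"
    using mean by (simp only: integral_mult_right_zero integral_complex_of_real has_bochner_integral_iff)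
  finally show ?thesis .
qed

text \<open>Transforming a single \<open>h5\<close> costs only the factor \<open>\<i>\<close>. Hence
  (1, 1) repeats the value of (2, 0) and (3, 1) that of (4, 0), up to \<open>\<i>\<close>; only (2,
  2) brings in a new moment.\<close>

lemma h5_wave_integral_values:
  "(LINT p|lborel. case_prod (h5_wave 0 0) p) = of_real (sqrt (2 * pi) * sqrt pi)"
  "(LINT p|lborel. case_prod (h5_wave 2 0) p) = of_real (sqrt (2 * pi))"
  "(LINT p|lborel. case_prod (h5_wave 4 0) p) = of_real (sqrt (2 * pi) * (16750800 / (3600 * sqrt pi)))"
  "(LINT p|lborel. case_prod (h5_wave 1 1) p) = \<i> * of_real (sqrt (2 * pi))"
  "(LINT p|lborel. case_prod (h5_wave 3 1) p) = \<i> * of_real (sqrt (2 * pi) * (16750800 / (3600 * sqrt pi)))"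
  "(LINT p|lborel. case_prod (h5_wave 2 2) p) = of_real (sqrt (2 * pi) * (176400 / (3600 * sqrt pi)))"
proof -
  have f0: "(LBINT y. of_real (gauss y * h5 y ^ 0) * cis (x * y)) = of_real (sqrt (2 * pi) * gauss x) * (1 * of_real 1)" for x
    using fourier_one[of x] by simp
  have f2: "(LBINT y. of_real (gauss y * h5 y ^ 2) * cis (x * y))
     = of_real (sqrt (2 * pi) * gauss x) * (1 * of_real (poly (Poly h5_numer_square_fourier) x / h5_denom ^ 2))" for x
    using fourier_h5_square[of x] by simp
  have "has_bochner_integral lborel (\<lambda>x. gauss x * gauss x * (h5 x ^ 0 * 1)) (sqrt pi)"
    using has_bochner_integral_gauss_moment[of 0] by (simp add: gauss_square)
  from h5_wave_integral[OF f0 this]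
  show "(LINT p|lborel. case_prod (h5_wave 0 0) p) = of_real (sqrt (2 * pi) * sqrt pi)"
    by simp
  show "(LINT p|lborel. case_prod (h5_wave 2 0) p) = of_real (sqrt (2 * pi))"
    using h5_wave_integral[OF f0, of 2] has_bochner_integral_h5_square by simp
  show "(LINT p|lborel. case_prod (h5_wave 4 0) p) = of_real (sqrt (2 * pi) * (16750800 / (3600 * sqrt pi)))"
    using h5_wave_integral[OF f0, of 4] has_bochner_integral_h5_fourth by simp
  show "(LINT p|lborel. case_prod (h5_wave 1 1) p) = \<i> * of_real (sqrt (2 * pi))"
    using h5_wave_integral[OF fourier_h5, of 1] has_bochner_integral_h5_square by (simp add: power2_eq_square)
  show "(LINT p|lborel. case_prod (h5_wave 3 1) p) = \<i> * of_real (sqrt (2 * pi) * (16750800 / (3600 * sqrt pi)))"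
    using h5_wave_integral[OF fourier_h5, of 3] has_bochner_integral_h5_fourth
    by (simp flip: power_Suc2)
  show "(LINT p|lborel. case_prod (h5_wave 2 2) p) = of_real (sqrt (2 * pi) * (176400 / (3600 * sqrt pi)))"
    using h5_wave_integral[OF f2 has_bochner_integral_h5_mixed] by simp
qed

definition sign_kernel_taylor :: "real \<Rightarrow> real \<Rightarrow> complex" where
  "sign_kernel_taylor a b = sign_kernel 0 0 - 2 * \<i> * of_real (a\<^sup>2 - 5 / 12 * a ^ 4) - 2 * \<i> * of_real (b\<^sup>2 - 5 / 12 * b ^ 4)
      + 4 * of_real (a * b - (a ^ 3 * b + a * b ^ 3) / 6) + \<i> * of_real (a\<^sup>2 * b\<^sup>2)"

lemma taylor_wave_expansion:
  "of_real (gauss x * gauss y) * cis (x * y) * sign_kernel_taylor (\<eta> * h5 x) (\<eta> * h5 y)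
   = sign_kernel 0 0 * h5_wave 0 0 x y
     + (- 2 * \<i> * of_real (\<eta> ^ 2)) * h5_wave 2 0 x y + (- 2 * \<i> * of_real (\<eta> ^ 2)) * h5_wave 0 2 x y
     + (5 / 6 * \<i> * of_real (\<eta> ^ 4)) * h5_wave 4 0 x y + (5 / 6 * \<i> * of_real (\<eta> ^ 4)) * h5_wave 0 4 x y
     + (4 * of_real (\<eta> ^ 2)) * h5_wave 1 1 x y
     + (- 2 / 3 * of_real (\<eta> ^ 4)) * h5_wave 3 1 x y + (- 2 / 3 * of_real (\<eta> ^ 4)) * h5_wave 1 3 x y
     + (\<i> * of_real (\<eta> ^ 4)) * h5_wave 2 2 x y" (is "?L = ?R")
proof -
  define e s t where "e = complex_of_real \<eta>" and "s = complex_of_real (h5 x)" and "t = complex_of_real (h5 y)"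
  have L: "?L = of_real (gauss x * gauss y) * cis (x * y) * (sign_kernel 0 0
      - 2 * \<i> * ((e * s)\<^sup>2 - 5 / 12 * (e * s) ^ 4) - 2 * \<i> * ((e * t)\<^sup>2 - 5 / 12 * (e * t) ^ 4)
      + 4 * ((e * s) * (e * t) - ((e * s) ^ 3 * (e * t) + (e * s) * (e * t) ^ 3) / 6) + \<i> * ((e * s)\<^sup>2 * (e * t)\<^sup>2))"
    by (simp add: sign_kernel_taylor_def e_def s_def t_def)
  have R: "?R = of_real (gauss x * gauss y) * cis (x * y) * (sign_kernel 0 0
     + (- 2 * \<i> * e ^ 2) * s ^ 2 + (- 2 * \<i> * e ^ 2) * t ^ 2
     + (5 / 6 * \<i> * e ^ 4) * s ^ 4 + (5 / 6 * \<i> * e ^ 4) * t ^ 4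
     + (4 * e ^ 2) * (s * t)
     + (- 2 / 3 * e ^ 4) * (s ^ 3 * t) + (- 2 / 3 * e ^ 4) * (s * t ^ 3)
     + (\<i> * e ^ 4) * (s ^ 2 * t ^ 2))"
    by (simp add: h5_wave_def e_def s_def t_def ring_distribs mult_ac)
  show ?thesis
    unfolding L R by (intro arg_cong2[where f = "(*)"] refl) (simp add: power_mult_distrib eval_nat_numeral field_simps)
qed

lemma taylor_integrable:
  "integrable lborel (\<lambda>(x, y). of_real (gauss x * gauss y) * cis (x * y) * sign_kernel_taylor (\<eta> * h5 x) (\<eta> * h5 y))"
  and taylor_integral:
  "(LINT (x, y)|lborel. of_real (gauss x * gauss y) * cis (x * y) * sign_kernel_taylor (\<eta> * h5 x) (\<eta> * h5 y))
   = \<i> * of_real (4 * pi * ln (1 + sqrt 2) + 1600 * sqrt 2 * \<eta> ^ 4)"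
proof -
  let ?w = "\<lambda>m n p. case_prod (h5_wave m n) p"
  have eq: "(case p of (x, y) \<Rightarrow> of_real (gauss x * gauss y) * cis (x * y) * sign_kernel_taylor (\<eta> * h5 x) (\<eta> * h5 y))
   = sign_kernel 0 0 * ?w 0 0 p
     + (- 2 * \<i> * of_real (\<eta> ^ 2)) * ?w 2 0 p + (- 2 * \<i> * of_real (\<eta> ^ 2)) * ?w 0 2 p
     + (5 / 6 * \<i> * of_real (\<eta> ^ 4)) * ?w 4 0 p + (5 / 6 * \<i> * of_real (\<eta> ^ 4)) * ?w 0 4 p
     + (4 * of_real (\<eta> ^ 2)) * ?w 1 1 p
     + (- 2 / 3 * of_real (\<eta> ^ 4)) * ?w 3 1 p + (- 2 / 3 * of_real (\<eta> ^ 4)) * ?w 1 3 p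
     + (\<i> * of_real (\<eta> ^ 4)) * ?w 2 2 p" for p
    by (cases p) (simp only: prod.case taylor_wave_expansion)
  show "integrable lborel (\<lambda>(x, y). of_real (gauss x * gauss y) * cis (x * y) * sign_kernel_taylor (\<eta> * h5 x) (\<eta> * h5 y))"
    unfolding eq by (intro Bochner_Integration.integrable_add integrable_mult_right integrable_h5_wave)
  have "(LINT (x, y)|lborel. of_real (gauss x * gauss y) * cis (x * y) * sign_kernel_taylor (\<eta> * h5 x) (\<eta> * h5 y))
    = sign_kernel 0 0 * integral\<^sup>L lborel (?w 0 0)
     + (- 2 * \<i> * of_real (\<eta> ^ 2)) * integral\<^sup>L lborel (?w 2 0) + (- 2 * \<i> * of_real (\<eta> ^ 2)) * integral\<^sup>L lborel (?w 0 2)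
     + (5 / 6 * \<i> * of_real (\<eta> ^ 4)) * integral\<^sup>L lborel (?w 4 0) + (5 / 6 * \<i> * of_real (\<eta> ^ 4)) * integral\<^sup>L lborel (?w 0 4)
     + (4 * of_real (\<eta> ^ 2)) * integral\<^sup>L lborel (?w 1 1)
     + (- 2 / 3 * of_real (\<eta> ^ 4)) * integral\<^sup>L lborel (?w 3 1) + (- 2 / 3 * of_real (\<eta> ^ 4)) * integral\<^sup>L lborel (?w 1 3)
     + (\<i> * of_real (\<eta> ^ 4)) * integral\<^sup>L lborel (?w 2 2)"
    unfolding eq by (simp only: Bochner_Integration.integral_add integral_mult_right_zero
      Bochner_Integration.integrable_add integrable_mult_right integrable_h5_wave)
  also have "\<dots> = \<i> * of_real (4 * pi * ln (1 + sqrt 2) + 1600 * sqrt 2 * \<eta> ^ 4)"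
  proof -
    define L S P M Q where "L = ln (1 + sqrt 2)" and "S = sqrt (2 * pi)" and "P = sqrt pi"
      and "M = 16750800 / (3600 * sqrt pi)" and "Q = 176400 / (3600 * sqrt pi)"
    have SP: "S * P = sqrt 2 * pi"
      by (simp add: S_def P_def real_sqrt_mult)
    \<comment> \<open>The coefficient of M is 2 * 5/6 - 2 * 2/3 = 1/3, from the pure fourth powers
      and the (3, 1) terms. With M and Q equal to 4653 and 49 over \<open>sqrt pi\<close>, the sum
      is 1551 + 49 = 1600 over \<open>sqrt pi\<close>.\<close>
    have SMQ: "S * (1 / 3 * M + Q) = 1600 * sqrt 2"
      by (simp add: S_def M_def Q_def real_sqrt_mult field_simps)
    \<comment> \<open>No term in \<open>\<eta>\<^sup>2\<close> is left: the two pure squares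
      contribute \<open>- 4 * \<i> * S\<close> and the product term
      \<open>4 * \<i> * S\<close>.\<close>
    have "4 * pi * L + 1600 * sqrt 2 * \<eta> ^ 4 = 2 * sqrt 2 * L * (S * P) + S * (1 / 3 * M + Q) * \<eta> ^ 4"
      unfolding SP SMQ by simp
    then show ?thesis
      unfolding h5_wave_integral_commute[of 0 2] h5_wave_integral_commute[of 0 4] h5_wave_integral_commute[of 1 3]
        h5_wave_integral_values sign_kernel_0_0 M_def[symmetric] Q_def[symmetric]
      unfolding L_def[symmetric] S_def[symmetric] P_def[symmetric]
      by (simp add: complex_eq_iff algebra_simps del: of_real_power)
  qed
  finally show "(LINT (x, y)|lborel. of_real (gauss x * gauss y) * cis (x * y) * sign_kernel_taylor (\<eta> * h5 x) (\<eta> * h5 y))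
   = \<i> * of_real (4 * pi * ln (1 + sqrt 2) + 1600 * sqrt 2 * \<eta> ^ 4)" .
qed

text \<open>R is 30 times a Gaussian integral of powers of \<open>h5\<close>, hence the same for all
  \<open>\<eta>\<close>. The eighth powers in the kernel error are absorbed because
  \<open>\<eta> ^ 8 \<le> \<eta> ^ 6\<close> for \<open>\<eta>\<close> below 1.\<close>

lemma H_eta_remainder:
  obtains R where "R \<ge> 0"
    "\<And>\<eta>. 0 < \<eta> \<Longrightarrow> \<eta> < 1 \<Longrightarrow>
      norm (H_eta \<eta> \<i> * (4 * of_real pi) - \<i> * of_real (4 * pi * ln (1 + sqrt 2) + 1600 * sqrt 2 * \<eta> ^ 4)) \<le> R * \<eta> ^ 6"
proof
  let ?R = "\<lambda>p :: real \<times> real. case p of (x, y) \<Rightarrow> gauss x * gauss y * (h5 x ^ 6 + h5 x ^ 8 + h5 y ^ 6 + h5 y ^ 8)"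
  have R_eq: "?R p = (case p of (x, y) \<Rightarrow> gauss x * h5 x ^ 6 * (gauss y * h5 y ^ 0)) + (case p of (x, y) \<Rightarrow> gauss x * h5 x ^ 8 * (gauss y * h5 y ^ 0))
    + (case p of (x, y) \<Rightarrow> gauss x * h5 x ^ 0 * (gauss y * h5 y ^ 6)) + (case p of (x, y) \<Rightarrow> gauss x * h5 x ^ 0 * (gauss y * h5 y ^ 8))" for p
    by (cases p) (simp add: algebra_simps)
  have R_int: "integrable lborel ?R"
    unfolding R_eq by (intro Bochner_Integration.integrable_add integrable_lborel_mult_prod integrable_gauss_h5_power)
  show "0 \<le> 30 * integral\<^sup>L lborel ?R"
    by (intro mult_nonneg_nonneg Bochner_Integration.integral_nonneg) (auto intro!: add_nonneg_nonneg)
  fix \<eta> :: real assume \<eta>: "0 < \<eta>" "\<eta> < 1"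
  let ?k = "\<lambda>x y. of_real (gauss x * gauss y) * cis (x * y) * sign_kernel (\<eta> * h5 x) (\<eta> * h5 y)"
  let ?t = "\<lambda>x y. of_real (gauss x * gauss y) * cis (x * y) * sign_kernel_taylor (\<eta> * h5 x) (\<eta> * h5 y)"
  have k_int: "integrable lborel (case_prod ?k)"
  proof (rule integrable_gauss_bound2[where C = "2 * pi"])
    have "(\<lambda>p. (\<eta> * h5 (fst p), \<eta> * h5 (snd p))) \<in> (borel \<Otimes>\<^sub>M borel) \<rightarrow>\<^sub>M (borel \<Otimes>\<^sub>M borel)"
      by measurable
    from measurable_compose[OF this sign_kernel_measurable]
    have [measurable]: "(\<lambda>p. sign_kernel (\<eta> * h5 (fst p)) (\<eta> * h5 (snd p))) \<in> borel_measurable (borel \<Otimes>\<^sub>M borel)"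
      by simp
    have "case_prod ?k \<in> borel_measurable (borel \<Otimes>\<^sub>M borel)"
      unfolding case_prod_unfold by measurable
    then show "case_prod ?k \<in> borel_measurable borel"
      by (simp add: borel_prod)
    fix x y
    show "norm (case (x, y) of (x, y) \<Rightarrow> ?k x y) \<le> 2 * pi * (gauss x * gauss y)"
      using mult_left_mono[OF sign_kernel_bound, of "gauss x * gauss y"] by (simp add: norm_mult abs_mult mult_ac)
  qed
  have "H_eta \<eta> \<i> * (4 * of_real pi) = integral\<^sup>L lborel (case_prod ?k)"
    unfolding H_eta_ii using lborel_integral_fst[OF k_int] by simp
  moreover have "integral\<^sup>L lborel (case_prod ?k) - \<i> * of_real (4 * pi * ln (1 + sqrt 2) + 1600 * sqrt 2 * \<eta> ^ 4)
    = (LINT p|lborel. case_prod ?k p - case_prod ?t p)"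
    unfolding taylor_integral[symmetric] using k_int taylor_integrable[of \<eta>]
    by (rule Bochner_Integration.integral_diff[symmetric])
  moreover have "norm (LINT p|lborel. case_prod ?k p - case_prod ?t p) \<le> (LINT p|lborel. 30 * \<eta> ^ 6 * ?R p)"
  proof (intro norm_integral_le integrable_mult_right R_int)
    fix p :: "real \<times> real"
    obtain x y where p: "p = (x, y)" by (cases p)
    let ?a = "\<eta> * h5 x" and ?b = "\<eta> * h5 y"
    have eta_le: "\<eta> ^ 8 * c ^ 8 \<le> \<eta> ^ 6 * c ^ 8" for c :: real
      using \<eta> by (intro mult_right_mono power_decreasing) auto
    have "norm (?k x y - ?t x y) = gauss x * gauss y * norm (sign_kernel ?a ?b - sign_kernel_taylor ?a ?b)"
      unfolding right_diff_distrib[symmetric] by (simp add: norm_mult abs_mult)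
    also have "\<dots> \<le> gauss x * gauss y * (30 * (?a ^ 6 + ?a ^ 8 + ?b ^ 6 + ?b ^ 8))"
      unfolding sign_kernel_taylor_def by (intro mult_left_mono sign_kernel_approx) auto
    also have "\<dots> \<le> gauss x * gauss y * (30 * (\<eta> ^ 6 * h5 x ^ 6 + \<eta> ^ 6 * h5 x ^ 8 + \<eta> ^ 6 * h5 y ^ 6 + \<eta> ^ 6 * h5 y ^ 8))"
      unfolding power_mult_distrib by (intro mult_left_mono add_mono eta_le) auto
    also have "\<dots> = 30 * \<eta> ^ 6 * ?R p"
      by (simp add: p algebra_simps)
    finally show "norm (case_prod ?k p - case_prod ?t p) \<le> 30 * \<eta> ^ 6 * ?R p"
      by (simp only: p prod.case)
  qed
  moreover have "(LINT p|lborel. 30 * \<eta> ^ 6 * ?R p) = 30 * integral\<^sup>L lborel ?R * \<eta> ^ 6"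
    by simp
  ultimately show "norm (H_eta \<eta> \<i> * (4 * of_real pi) - \<i> * of_real (4 * pi * ln (1 + sqrt 2) + 1600 * sqrt 2 * \<eta> ^ 4))
     \<le> 30 * integral\<^sup>L lborel ?R * \<eta> ^ 6"
    by (simp only:)
qed

text \<open>Under reflection of x, oddness of \<open>h5\<close> and
  \<open>sign_kernel_minus_left\<close> turn the inner integral into minus its conjugate. The whole
  integral then equals minus its own conjugate, so it is purely imaginary.\<close>

lemma Re_H_eta: "Re (H_eta \<eta> \<i>) = 0"
proof -
  let ?\<Phi> = "\<lambda>x. LBINT y. of_real (gauss x * gauss y) * cis (x * y) * sign_kernel (\<eta> * h5 x) (\<eta> * h5 y)"
  have "?\<Phi> (- x) = - cnj (?\<Phi> x)" for x
  proof -
    have "of_real (gauss (- x) * gauss y) * cis (- x * y) * sign_kernel (\<eta> * h5 (- x)) (\<eta> * h5 y)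
      = - cnj (of_real (gauss x * gauss y) * cis (x * y) * sign_kernel (\<eta> * h5 x) (\<eta> * h5 y))" for y
      by (simp add: h5_minus sign_kernel_minus_left cis_cnj)
    then show ?thesis
      by (simp only: Bochner_Integration.integral_minus Bochner_Integration.integral_cnj)
  qed
  then have "integral\<^sup>L lborel ?\<Phi> = - cnj (integral\<^sup>L lborel ?\<Phi>)"
    using lborel_integral_real_affine[of "- 1" ?\<Phi> 0]
    by (simp only: Bochner_Integration.integral_minus Bochner_Integration.integral_cnj) simp
  then have "Re (integral\<^sup>L lborel ?\<Phi>) = 0"
    by (simp add: complex_eq_iff)
  then show ?thesis
    by (simp add: H_eta_ii Re_divide)
qed

theorem theorem4p4:
  "\<exists>\<eta>\<^sub>0::real. \<eta>\<^sub>0 > 0 \<and>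
     (\<forall>\<eta>\<in>{0<..<1}. \<eta> < \<eta>\<^sub>0 \<longrightarrow>
        H_eta \<eta> \<i> / \<i> \<in> complex_of_real ` {ln (1 + sqrt 2)<..})"
proof -
  obtain R where R: "R \<ge> 0"
    "\<And>\<eta>. 0 < \<eta> \<Longrightarrow> \<eta> < 1 \<Longrightarrow>
      norm (H_eta \<eta> \<i> * (4 * of_real pi) - \<i> * of_real (4 * pi * ln (1 + sqrt 2) + 1600 * sqrt 2 * \<eta> ^ 4)) \<le> R * \<eta> ^ 6"
    using H_eta_remainder by blast
  show ?thesis
  proof (intro exI conjI ballI impI)
    \<comment> \<open>This threshold forces \<open>R * \<eta> < 1\<close>, so the error
      \<open>R * \<eta> ^ 6\<close> is below \<open>\<eta> ^ 5\<close> and hence below the quartic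
      gain.\<close>
    show "1 / (R + 1) > 0"
      using R(1) by simp
    fix \<eta> :: real assume "\<eta> \<in> {0<..<1}" and "\<eta> < 1 / (R + 1)"
    then have \<eta>: "0 < \<eta>" "\<eta> < 1" and "R * \<eta> + \<eta> < 1"
      using R(1) by (auto simp: field_simps)
    then have "R * \<eta> < 1" by simp
    then have "R * \<eta> * \<eta> ^ 5 < 1 * \<eta> ^ 5"
      using \<eta> by (intro mult_strict_right_mono) auto
    also have "\<eta> ^ 5 \<le> \<eta> ^ 4"
      using \<eta> by (intro power_decreasing) auto
    also have "\<eta> ^ 4 \<le> 1600 * sqrt 2 * \<eta> ^ 4"
    proof -
      have "1 \<le> sqrt 2"
        by simp
      then have "1 \<le> 1600 * sqrt 2"
        by linarith
      then show ?thesis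
        using mult_right_mono[of 1 "1600 * sqrt 2" "\<eta> ^ 4"] by simp
    qed
    finally have small: "R * \<eta> ^ 6 < 1600 * sqrt 2 * \<eta> ^ 4"
      by (simp add: eval_nat_numeral mult_ac)
    let ?h = "H_eta \<eta> \<i>"
    have "\<bar>Im (?h * (4 * of_real pi) - \<i> * of_real (4 * pi * ln (1 + sqrt 2) + 1600 * sqrt 2 * \<eta> ^ 4))\<bar> \<le> R * \<eta> ^ 6"
      by (rule order_trans[OF abs_Im_le_cmod R(2)[OF \<eta>]])
    then have "\<bar>4 * pi * Im ?h - (4 * pi * ln (1 + sqrt 2) + 1600 * sqrt 2 * \<eta> ^ 4)\<bar> \<le> R * \<eta> ^ 6"
      by (simp add: mult_ac)
    with small have "4 * pi * ln (1 + sqrt 2) < 4 * pi * Im ?h"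
      by linarith
    then have "ln (1 + sqrt 2) < Im ?h"
      by simp
    moreover have "?h / \<i> = of_real (Im ?h)"
      using Re_H_eta[of \<eta>] by (simp add: complex_eq_iff Re_divide Im_divide)
    ultimately show "?h / \<i> \<in> complex_of_real ` {ln (1 + sqrt 2)<..}"
      by auto
  qed
qed

end
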